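(* Let $(P,\lambda)$ be a $(\mathbb{Z}_2)^n$-colored simple $n$-polytope with a sector $i:S\to P$, let $(\psi,\rho)$ be an isomorphism pair preserving $(S,\bar\lambda)$, let $v_0\in(\mathbb{Z}_2)^n$, and let $(P',\lambda')$ be a colored simple polytope obtained from $(P,\lambda)$ by $(\psi,\rho)$ at the sector $i$ (see context). If $\Psi(\psi,\rho,v_0)$ is a good twist, then $M(\lambda)$ is homeomorphic to $M(\lambda')$.
   Context: Simple polytopes are simple convex polytopes embedded in $\mathbb{R}^n$; $\mathcal{F}(P)$ is the set of facets of $P$; $\mathrm{Aut}(S)$ is the group of self-homeomorphisms of the polytope $S$ as a manifold with corners (the induced permutation of $\mathcal{F}(S)$ is denoted by the same letter). A $(\mathbb{Z}_2)^n$-coloring on a simple $n$-polytope $P$ is a map $\lambda:\mathcal{F}(P)\to(\mathbb{Z}_2)^n$ such that whenever facets have nonempty common intersection their images are linearly independent. Put $M(\lambda)=P\times(\mathbb{Z}_2)^n/\sim$, with $\sim$ generated by $(p,v)\sim(p,v+\lambda(F))$ for $p\in F\in\mathcal{F}(P)$. The class of $(p,v)$ is written $\{(p,v)\}$. Sector: for a simple $(n-1)$-polytope $S$, an embedding $i:S\to P$ is a sector if (a) $i(S)$ divides $P$ into two simple $n$-polytopes $P_1,P_2$ with $i(S)$ their common facet; (b) for every $k$-face $F\subset S$ there is a unique $(k+1)$-dimensional face $H$ of $P$ with $i(F)\subset H$ (in particular $i(S)$ contains no vertex of $P$). Then $i$ induces $i_*:\mathcal{F}(S)\to\mathcal{F}(P)$,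 and $\bar\lambda=\lambda\circ i_*$ is the derived coloring. Let $i_r:S\to P_r$ ($r=1,2$) be induced by $i$, so $P=P_1\coprod P_2/i_1(s)\sim i_2(s)$. An isomorphism pair preserving $(S,\bar\lambda)$ is a pair $(\psi,\rho)$ with $\psi\in\mathrm{Aut}(S)$, $\rho\in \mathrm{GL}(n,\mathbb{Z}_2)$ and $\bar\lambda\circ\psi=\rho\circ\bar\lambda$. Construction of $(P',\lambda')$: $P'$ is a simple $n$-polytope with a sector $j:S\to P'$ cutting $P'$ into $P_1',P_2'$ (with induced embeddings $j_r:S\to P'_r$), for which there are combinatorial equivalences (homeomorphisms of manifolds with corners) $g_r:P_r\to P_r'$, $r=1,2$, with $g_1\circ i_1=j_1$ and $g_2\circ i_2\circ\psi=j_2$. For $F\in\mathcal{F}(P')$: if $F\cap P_1'\ne\emptyset$ let $F_1\in\mathcal{F}(P)$ be the unique facet of $P$ meeting $P_1$ with $g_1(F_1\cap P_1)\subset F$; if $F\cap P_2'\neq\emptyset$ let $F_2\in\mathcal{F}(P)$ be the unique facet of $P$ meeting $P_2$ with $g_2(F_2\cap P_2)\subset F$. Then $\lambda'(F)=\lambda(F_1)$ if $F\cap P_1'\ne\emptyset$ and $\lambda'(F)=\rho^{-1}(\lambda(F_2))$ if $F\cap P_2'\neq\emptyset$; this is a well-defined $(\mathbb{Z}_2)^n$-coloring on $P'$, and $M(\lambda')=P'\times(\mathbb{Z}_2)^n/\sim$, with $\sim$ generated by $(p,v)\sim(p,v+\lambda'(F))$ for $p\in F\in\mathcal{F}(P')$.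 Sector manifold: $\mathcal{S}=S\times(\mathbb{Z}_2)^n/\sim$, with $\sim$ generated by $(s,v)\sim(s,v+\bar\lambda(f))$ for $s\in f\in\mathcal{F}(S)$; it is a closed $(n-1)$-manifold. The homeomorphism $\Psi=\Psi(\psi,\rho,v_0):\mathcal{S}\to\mathcal{S}$ is $\{(s,v)\}\mapsto\{(\psi(s),\rho(v)+v_0)\}$. $\Psi(\psi,\rho,v_0)$ is called a good twist if it is isotopic to the identity of $\mathcal{S}$. *)

theory Defs
  imports "HOL-Analysis.Analysis" "HOL-Library.Z2"
begin

definition facets :: "'a::euclidean_space set \<Rightarrow> 'a set set" where
  "facets P = {F. F facet_of P}"

definition simple_polytope :: "nat \<Rightarrow> 'a::euclidean_space set \<Rightarrow> bool" where
  "simple_polytope k P \<longleftrightarrow> polytope P \<and> aff_dim P = int k \<and>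
     (\<forall>v. {v} face_of P \<longrightarrow> card {F \<in> facets P. v \<in> F} = k)"

text \<open>
  (Z/2)^n is rendered as \<^typ>\<open>bit ^ 'n\<close>, with n = CARD('n). Linear independence is that of
  the family of colors indexed by the facets, so distinct facets with a common point must also
  have distinct colors.
\<close>

definition coloring :: "(real ^ 'n) set \<Rightarrow> ((real ^ 'n) set \<Rightarrow> bit ^ 'n) \<Rightarrow> bool" where
  "coloring P c \<longleftrightarrow>
     (\<forall>\<G> \<subseteq> facets P. \<Inter>\<G> \<noteq> {} \<longrightarrow> inj_on c \<G> \<and> vec.independent (c ` \<G>))"


subsection \<open>The spaces glued from copies of a polytope\<close>

definition quotient_top :: "'a topology \<Rightarrow> ('a \<Rightarrow> 'b) \<Rightarrow> 'b topology" where
  "quotient_top X q =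
     topology (\<lambda>U. U \<subseteq> q ` topspace X \<and> openin X {x \<in> topspace X. q x \<in> U})"

lemma openin_quotient_top:
  "openin (quotient_top X q) U \<longleftrightarrow>
     U \<subseteq> q ` topspace X \<and> openin X {x \<in> topspace X. q x \<in> U}"
proof -
  have "istopology (\<lambda>U. U \<subseteq> q ` topspace X \<and> openin X {x \<in> topspace X. q x \<in> U})"
    unfolding istopology_def
  proof (intro conjI allI impI)
    fix A B
    assume "A \<subseteq> q ` topspace X \<and> openin X {x \<in> topspace X. q x \<in> A}"
      and "B \<subseteq> q ` topspace X \<and> openin X {x \<in> topspace X. q x \<in> B}"
    moreover have "{x \<in> topspace X. q x \<in> A \<inter> B} =
        {x \<in> topspace X. q x \<in> A} \<inter> {x \<in> topspace X. q x \<in> B}"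
      by auto
    ultimately show "A \<inter> B \<subseteq> q ` topspace X"
      and "openin X {x \<in> topspace X. q x \<in> A \<inter> B}"
      by (auto simp del: Int_iff)
  next
    fix K
    assume K: "\<forall>A\<in>K. A \<subseteq> q ` topspace X \<and> openin X {x \<in> topspace X. q x \<in> A}"
    then show "\<Union>K \<subseteq> q ` topspace X"
      by blast
    have "{x \<in> topspace X. q x \<in> \<Union>K} = (\<Union>A\<in>K. {x \<in> topspace X. q x \<in> A})"
      by auto
    moreover have "openin X (\<Union>A\<in>K. {x \<in> topspace X. q x \<in> A})"
      using K by (intro openin_Union) auto
    ultimately show "openin X {x \<in> topspace X. q x \<in> \<Union>K}"
      by simp
  qed
  then show ?thesis
    by (simp add: quotient_top_def)
qed

lemma topspace_quotient_top [simp]: "topspace (quotient_top X q) = q ` topspace X"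
proof -
  have "{x \<in> topspace X. q x \<in> q ` topspace X} = topspace X"
    by auto
  then have "openin (quotient_top X q) (q ` topspace X)"
    by (simp add: openin_quotient_top)
  then show ?thesis
    by (metis openin_quotient_top openin_subset openin_topspace subset_antisym)
qed

lemma quotient_map_quotient_top: "quotient_map X (quotient_top X q) q"
  by (auto simp: quotient_map_def openin_quotient_top)

definition glue_step ::
    "'a::euclidean_space set \<Rightarrow> ('a set \<Rightarrow> bit ^ 'n) \<Rightarrow>
     'a \<times> (bit ^ 'n) \<Rightarrow> 'a \<times> (bit ^ 'n) \<Rightarrow> bool" where
  "glue_step Q c x y \<longleftrightarrow>
     (\<exists>p v F. F \<in> facets Q \<and> p \<in> F \<and> x = (p, v) \<and> y = (p, v + c F))"

definition glue_class ::
    "'a::euclidean_space set \<Rightarrow> ('a set \<Rightarrow> bit ^ 'n) \<Rightarrow>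
     'a \<times> (bit ^ 'n) \<Rightarrow> ('a \<times> (bit ^ 'n)) set" where
  "glue_class Q c x = {y. equivclp (glue_step Q c) x y}"

text \<open>
  For a colored n-polytope this is the space M; applied to a sector and its derived coloring, it is
  the sector manifold.
\<close>

definition glued_space ::
    "'a::euclidean_space set \<Rightarrow> ('a set \<Rightarrow> bit ^ 'n) \<Rightarrow> ('a \<times> (bit ^ 'n)) set topology" where
  "glued_space Q c =
     quotient_top (prod_topology (top_of_set Q) (discrete_topology UNIV)) (glue_class Q c)"


subsection \<open>Sectors\<close>

text \<open>
  A polytope, or a piece of one, is treated as a manifold with corners by recording a set together
  with the set of its facets. The faces of a simple polytope are the intersections of its facets,
  so a homeomorphism of manifolds with corners is one that maps facets onto facets.
\<close>

definition corner_homeo ::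
    "'a::euclidean_space set \<Rightarrow> 'a set set \<Rightarrow> 'b::euclidean_space set \<Rightarrow> 'b set set \<Rightarrow>
     ('a \<Rightarrow> 'b) \<Rightarrow> bool" where
  "corner_homeo X \<F> Y \<G> f \<longleftrightarrow>
     homeomorphic_map (top_of_set X) (top_of_set Y) f \<and> (\<lambda>F. f ` F) ` \<F> = \<G>"

definition Aut :: "'a::euclidean_space set \<Rightarrow> ('a \<Rightarrow> 'a) set" where
  "Aut S = {\<psi>. corner_homeo S (facets S) S (facets S) \<psi>}"

text \<open>The facets of a piece R of P that is cut off along T.\<close>

definition piece_facets ::
    "'a::euclidean_space set \<Rightarrow> 'a set \<Rightarrow> 'a set \<Rightarrow> 'a set set" where
  "piece_facets P T R = insert T {F \<inter> R | F. F \<in> facets P \<and> F \<inter> R \<noteq> {}}"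

text \<open>
  The image of a sector need not be flat, so the two pieces need not be convex; they are required
  to be simple polytopes as manifolds with corners. If they are convex polytopes with the image of
  the sector as a common facet, and the last condition holds, then \<^const>\<open>piece_facets\<close> gives
  precisely their facets.
\<close>

definition sector ::
    "'b::euclidean_space set \<Rightarrow> (real ^ 'n) set \<Rightarrow> ('b \<Rightarrow> real ^ 'n) \<Rightarrow>
     (real ^ 'n) set \<Rightarrow> (real ^ 'n) set \<Rightarrow> bool" where
  "sector S P i P1 P2 \<longleftrightarrow>
     embedding_map (top_of_set S) (top_of_set P) i \<and>
     P1 \<union> P2 = P \<and> P1 \<inter> P2 = i ` S \<and>
     (\<forall>R \<in> {P1, P2}. \<exists>(Q :: (real ^ 'n) set) h.
        simple_polytope CARD('n) Q \<and> corner_homeo R (piece_facets P (i ` S) R) Q (facets Q) h) \<and>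
     (\<forall>F. F face_of S \<and> F \<noteq> {} \<longrightarrow>
        (\<exists>!H. H face_of P \<and> aff_dim H = aff_dim F + 1 \<and> i ` F \<subseteq> H))"

definition induced_facet ::
    "(real ^ 'n) set \<Rightarrow> ('b::euclidean_space \<Rightarrow> real ^ 'n) \<Rightarrow> 'b set \<Rightarrow> (real ^ 'n) set" where
  "induced_facet P i f = (THE H. H face_of P \<and> aff_dim H = aff_dim f + 1 \<and> i ` f \<subseteq> H)"

definition derived_coloring ::
    "(real ^ 'n) set \<Rightarrow> ((real ^ 'n) set \<Rightarrow> bit ^ 'n) \<Rightarrow>
     ('b::euclidean_space \<Rightarrow> real ^ 'n) \<Rightarrow> 'b set \<Rightarrow> bit ^ 'n" where
  "derived_coloring P c i = c \<circ> induced_facet P i"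

definition iso_pair ::
    "'b::euclidean_space set \<Rightarrow> ('b set \<Rightarrow> bit ^ 'n) \<Rightarrow> ('b \<Rightarrow> 'b) \<Rightarrow> bit ^ 'n ^ 'n \<Rightarrow> bool" where
  "iso_pair S c \<psi> \<rho> \<longleftrightarrow>
     \<psi> \<in> Aut S \<and> invertible \<rho> \<and> (\<forall>f \<in> facets S. c (\<psi> ` f) = \<rho> *v c f)"


subsection \<open>Cutting and regluing\<close>

text \<open>
  In the last two clauses a facet F of P' determines F1 and F2 uniquely, whenever it meets the
  first or the second piece of P', respectively.
\<close>

definition obtained_by ::
    "'b::euclidean_space set \<Rightarrow> (real ^ 'n) set \<Rightarrow> ((real ^ 'n) set \<Rightarrow> bit ^ 'n) \<Rightarrow>
     ('b \<Rightarrow> real ^ 'n) \<Rightarrow> (real ^ 'n) set \<Rightarrow> (real ^ 'n) set \<Rightarrow> ('b \<Rightarrow> 'b) \<Rightarrow> bit ^ 'n ^ 'n \<Rightarrow>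
     (real ^ 'n) set \<Rightarrow> ((real ^ 'n) set \<Rightarrow> bit ^ 'n) \<Rightarrow> bool" where
  "obtained_by S P c i P1 P2 \<psi> \<rho> P' c' \<longleftrightarrow>
     (\<exists>j P1' P2' g1 g2.
        sector S P' j P1' P2' \<and>
        corner_homeo P1 (piece_facets P (i ` S) P1) P1' (piece_facets P' (j ` S) P1') g1 \<and>
        corner_homeo P2 (piece_facets P (i ` S) P2) P2' (piece_facets P' (j ` S) P2') g2 \<and>
        (\<forall>s \<in> S. g1 (i s) = j s) \<and>
        (\<forall>s \<in> S. g2 (i (\<psi> s)) = j s) \<and>
        (\<forall>F \<in> facets P'. F \<inter> P1' \<noteq> {} \<longrightarrow>
           (\<forall>F1 \<in> facets P. F1 \<inter> P1 \<noteq> {} \<and> g1 ` (F1 \<inter> P1) \<subseteq> F \<longrightarrow> c' F = c F1)) \<and>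
        (\<forall>F \<in> facets P'. F \<inter> P2' \<noteq> {} \<longrightarrow>
           (\<forall>F2 \<in> facets P. F2 \<inter> P2 \<noteq> {} \<and> g2 ` (F2 \<inter> P2) \<subseteq> F \<longrightarrow>
              c' F = matrix_inv \<rho> *v c F2)))"


subsection \<open>Good twists\<close>

text \<open>
  The union only lifts the map on representatives to classes: for an isomorphism pair all
  representatives yield the same class.
\<close>

definition twist ::
    "'b::euclidean_space set \<Rightarrow> ('b set \<Rightarrow> bit ^ 'n) \<Rightarrow> ('b \<Rightarrow> 'b) \<Rightarrow> bit ^ 'n ^ 'n \<Rightarrow> bit ^ 'n \<Rightarrow>
     ('b \<times> (bit ^ 'n)) set \<Rightarrow> ('b \<times> (bit ^ 'n)) set" where
  "twist S c \<psi> \<rho> v0 C = (\<Union>(s, v) \<in> C. glue_class S c (\<psi> s, \<rho> *v v + v0))"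

definition isotopic_to_id :: "'a topology \<Rightarrow> ('a \<Rightarrow> 'a) \<Rightarrow> bool" where
  "isotopic_to_id X f \<longleftrightarrow> homotopic_with (homeomorphic_map X X) X X f id"

definition good_twist ::
    "'b::euclidean_space set \<Rightarrow> ('b set \<Rightarrow> bit ^ 'n) \<Rightarrow> ('b \<Rightarrow> 'b) \<Rightarrow> bit ^ 'n ^ 'n \<Rightarrow> bit ^ 'n \<Rightarrow>
     bool" where
  "good_twist S c \<psi> \<rho> v0 \<longleftrightarrow> isotopic_to_id (glued_space S c) (twist S c \<psi> \<rho> v0)"

end

theory Submission
  imports Defs
begin

text \<open>
  Both spaces are glued from the same two pieces, the images of P1 and P2 (times the colors), along
  copies of the sector manifold; on the second piece the identification
  \<open>(p, v) \<mapsto> (g2 p, \<rho>\<^sup>-\<^sup>1 (v - v0))\<close> disagrees on the sector with the one given by g1 exactly by the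
  twist. As the twist is isotopic to the identity, the disagreement can be undone by running the
  isotopy along a collar of the sector manifold in the second piece. That collar comes from a
  collar of a facet of the simple polytope modelling P2 that respects all other facets.
\<close>

subsection \<open>Simple polytopes in half-space form\<close>

text \<open>The stages of the isotopy need not come from maps of \<open>S\<close>; they only act on
  classes in the sector manifold. Hence the collar has to be parametrised by classes too: it must
  descend from \<open>S\<close> to the sector manifold. It does so when each collar line stays in
  exactly those facets of \<open>P\<close> that pass through its starting point, for then the group
  of colors identified along the line is constant. This takes two geometric facts. A facet needs a
  collar that neither enters nor leaves any other facet; half-space coordinates and simplicity serve
  to build it. And the facets of \<open>P\<close> through a sector point must be exactly those
  induced by facets of \<open>S\<close> through that point; the definition of a sector yields one
  inclusion directly, while the other one takes invariance of domain. As the image of a sector may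
  be curved, both arguments run in the convex model of a piece. The rest is topology: the glued
  spaces are compact and Hausdorff, so a continuous surjection with the right fibres is enough and
  no inverse has to be written down.\<close>

lemma simple_polytopeD:
  assumes "simple_polytope k P"
  shows "polytope P" "compact P" "convex P" "polyhedron P" "closed P"
    "finite (facets P)" "\<And>F. F \<in> facets P \<Longrightarrow> F \<subseteq> P" "\<And>F. F \<in> facets P \<Longrightarrow> closed F"
proof -
  show P: "polytope P"
    using assms by (simp add: simple_polytope_def)
  then show "compact P" "convex P" "polyhedron P" "closed P"
    by (auto simp: polytope_imp_compact polytope_imp_convex polytope_imp_polyhedron
        polytope_imp_closed)
  then show "finite (facets P)"
    by (simp add: facets_def finite_polyhedron_facets)
  show "F \<subseteq> P" if "F \<in> facets P" for F
    using that by (simp add: facets_def facet_of_imp_subset)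
  show "closed F" if "F \<in> facets P" for F
    using that P by (auto simp: facets_def intro: face_of_polytope_polytope
        polytope_imp_closed facet_of_imp_face_of)
qed

section \<open>Lipschitz functions on a compact set\<close>

lemma lipschitz_scaleR:
  fixes f :: "'a::metric_space \<Rightarrow> real" and g :: "'a \<Rightarrow> 'b::real_normed_vector"
  assumes "compact X" "L-lipschitz_on X f" "M-lipschitz_on X g"
  shows "\<exists>K. K-lipschitz_on X (\<lambda>x. f x *\<^sub>R g x)"
proof -
  have "bounded (f ` X)" "bounded (g ` X)"
    using assms by (meson compact_continuous_image compact_imp_bounded
        lipschitz_on_continuous_on)+
  then obtain A B where A: "\<And>x. x \<in> X \<Longrightarrow> \<bar>f x\<bar> \<le> A" "A > 0"
    and B: "\<And>x. x \<in> X \<Longrightarrow> norm (g x) \<le> B" "B > 0"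
    unfolding bounded_pos by auto
  have L: "L \<ge> 0" "M \<ge> 0"
    using assms lipschitz_on_nonneg by auto
  have "(A * M + L * B)-lipschitz_on X (\<lambda>x. f x *\<^sub>R g x)"
  proof (rule lipschitz_onI)
    fix x y assume xy: "x \<in> X" "y \<in> X"
    have "f x *\<^sub>R g x - f y *\<^sub>R g y = f x *\<^sub>R (g x - g y) + (f x - f y) *\<^sub>R g y"
      by (simp add: algebra_simps)
    then have "dist (f x *\<^sub>R g x) (f y *\<^sub>R g y) \<le>
        \<bar>f x\<bar> * norm (g x - g y) + \<bar>f x - f y\<bar> * norm (g y)"
      by (metis dist_norm norm_scaleR norm_triangle_ineq)
    also have "\<dots> \<le> A * (M * dist x y) + (L * dist x y) * B"
      using A B xy lipschitz_onD[OF assms(2) xy] lipschitz_onD[OF assms(3) xy] L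
      by (intro add_mono mult_mono) (auto simp: dist_norm)
    finally show "dist (f x *\<^sub>R g x) (f y *\<^sub>R g y) \<le> (A * M + L * B) * dist x y"
      by (simp add: algebra_simps)
  qed (use A B L in auto)
  then show ?thesis ..
qed

lemma lipschitz_sum:
  fixes f :: "'i \<Rightarrow> 'a::metric_space \<Rightarrow> 'b::real_normed_vector"
  assumes "finite I" "\<And>i. i \<in> I \<Longrightarrow> \<exists>L. L-lipschitz_on X (f i)"
  shows "\<exists>L. L-lipschitz_on X (\<lambda>x. \<Sum>i\<in>I. f i x)"
  using assms
proof (induction rule: finite_induct)
  case empty
  then show ?case by (auto intro: lipschitz_on_constant)
next
  case (insert i I)
  then obtain L M where "L-lipschitz_on X (f i)" "M-lipschitz_on X (\<lambda>x. \<Sum>i\<in>I. f i x)"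
    by blast
  then show ?case
    using insert by (auto intro: lipschitz_on_add)
qed

lemma lipschitz_prod:
  fixes f :: "'i \<Rightarrow> 'a::metric_space \<Rightarrow> real"
  assumes "finite I" "compact X" "\<And>i. i \<in> I \<Longrightarrow> \<exists>L. L-lipschitz_on X (f i)"
  shows "\<exists>L. L-lipschitz_on X (\<lambda>x. \<Prod>i\<in>I. f i x)"
  using assms
proof (induction rule: finite_induct)
  case empty
  then show ?case by (auto intro: lipschitz_on_constant)
next
  case (insert i I)
  then obtain L M where "L-lipschitz_on X (f i)" "M-lipschitz_on X (\<lambda>x. \<Prod>i\<in>I. f i x)"
    by blast
  then show ?case
    using insert lipschitz_scaleR[of X L "f i" M "\<lambda>x. \<Prod>i\<in>I. f i x"] by auto
qed

lemma lipschitz_inverse: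
  fixes f :: "'a::metric_space \<Rightarrow> real"
  assumes "compact X" "L-lipschitz_on X f" "\<And>x. x \<in> X \<Longrightarrow> f x > 0"
  shows "\<exists>K. K-lipschitz_on X (\<lambda>x. inverse (f x))"
proof -
  have "continuous_on X (\<lambda>x. inverse (f x))"
    using assms lipschitz_on_continuous_on[OF assms(2)]
    by (intro continuous_on_inverse) force+
  then have "bounded ((\<lambda>x. inverse (f x)) ` X)"
    using assms(1) by (meson compact_continuous_image compact_imp_bounded)
  then obtain B where B: "\<And>x. x \<in> X \<Longrightarrow> \<bar>inverse (f x)\<bar> \<le> B" "B > 0"
    unfolding bounded_pos by auto
  have L: "L \<ge> 0"
    using assms lipschitz_on_nonneg by auto
  have "(B * (L * B))-lipschitz_on X (\<lambda>x. inverse (f x))"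
  proof (rule lipschitz_onI)
    fix x y assume xy: "x \<in> X" "y \<in> X"
    have "inverse (f x) - inverse (f y) = inverse (f x) * ((f y - f x) * inverse (f y))"
      using assms(3)[OF xy(1)] assms(3)[OF xy(2)] by (simp add: field_simps)
    then have "dist (inverse (f x)) (inverse (f y)) =
        \<bar>inverse (f x)\<bar> * (\<bar>f x - f y\<bar> * \<bar>inverse (f y)\<bar>)"
      by (metis abs_minus_commute abs_mult dist_real_def)
    also have "\<dots> \<le> B * ((L * dist x y) * B)"
      using B xy lipschitz_onD[OF assms(2) xy] L
      by (intro mult_mono) (auto simp: dist_norm)
    finally show "dist (inverse (f x)) (inverse (f y)) \<le> B * (L * B) * dist x y"
      by (simp add: algebra_simps)
  qed (use B L in auto)
  then show ?thesis ..
qed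

text \<open>Full dimension makes the frontier the union of the facets. If a point x outside Q
  satisfied all inequalities, the segment from an interior point z to x would cross the frontier in
  some facet G; the inequality of G is strict at z and weak at x, so it is strict at the crossing
  point, which lies on G.\<close>

lemma polytope_facet_halfspaces:
  fixes Q :: "'a::euclidean_space set"
  assumes "polytope Q" "aff_dim Q = int DIM('a)"
  obtains n b where "\<forall>G \<in> facets Q. G = {x \<in> Q. n G \<bullet> x = b G}"
    "Q = {x. \<forall>G \<in> facets Q. n G \<bullet> x \<le> (b G :: real)}"
proof -
  have Q: "polyhedron Q" "closed Q" "convex Q"
    using assms by (auto simp: polytope_imp_polyhedron polytope_imp_closed polytope_imp_convex)
  have "\<exists>a c. (Q \<subseteq> {x. a \<bullet> x \<le> c}) \<and> G = Q \<inter> {x. a \<bullet> x = c}" if "G \<in> facets Q" for G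
    using facet_of_polyhedron[OF Q(1), of G] that unfolding facets_def by blast
  then obtain n b where nb: "\<And>G. G \<in> facets Q \<Longrightarrow>
      (Q \<subseteq> {x. n G \<bullet> x \<le> b G}) \<and> G = Q \<inter> {x. n G \<bullet> x = b G}"
    by metis
  have hull: "affine hull Q = UNIV"
    using assms(2) by (simp add: aff_dim_eq_full)
  have "Q \<noteq> {}"
    using assms(2) by auto
  then have "interior Q \<noteq> {}"
    using rel_interior_interior[OF hull] rel_interior_eq_empty[OF Q(3)] by simp
  then obtain z where z: "z \<in> interior Q" by auto
  have fr: "frontier Q = \<Union> (facets Q)"
    using rel_frontier_of_polyhedron[OF Q(1)] hull
    by (simp add: facets_def rel_frontier_frontier)
  have notface: "z \<notin> G" if "G \<in> facets Q" for G
    using z fr that by (auto simp: frontier_def)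
  have "x \<in> Q" if x: "\<forall>G \<in> facets Q. n G \<bullet> x \<le> b G" for x
  proof (rule ccontr)
    assume "x \<notin> Q"
    moreover have "z \<in> Q"
      using z interior_subset by auto
    ultimately have "closed_segment z x \<inter> frontier Q \<noteq> {}"
      by (intro connected_Int_frontier) auto
    then obtain y G where y: "y \<in> closed_segment z x" "G \<in> facets Q" "y \<in> G"
      using fr by auto
    then have yQ: "y \<in> Q" "n G \<bullet> y = b G"
      using nb by auto
    obtain u where u: "0 \<le> u" "u \<le> 1" "y = (1 - u) *\<^sub>R z + u *\<^sub>R x"
      using y(1) by (auto simp: closed_segment_def)
    have "u \<noteq> 1"
      using u yQ \<open>x \<notin> Q\<close> by auto
    then have "u < 1" using u by simp
    have zl: "n G \<bullet> z < b G"
      using nb[OF y(2)] notface[OF y(2)] \<open>z \<in> Q\<close> by force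
    have "n G \<bullet> y = (1 - u) * (n G \<bullet> z) + u * (n G \<bullet> x)"
      using u by (simp add: inner_add_right)
    also have "\<dots> < (1 - u) * b G + u * b G"
      using \<open>u < 1\<close> zl x y(2) u(1) by (intro add_less_le_mono mult_strict_left_mono mult_left_mono) auto
    finally show False
      using yQ by (simp add: algebra_simps)
  qed
  then have "Q = {x. \<forall>G \<in> facets Q. n G \<bullet> x \<le> b G}"
    using nb by blast
  moreover have "\<forall>G \<in> facets Q. G = {x \<in> Q. n G \<bullet> x = b G}"
    using nb by (simp add: Int_def)
  ultimately show ?thesis
    by (rule that[rotated])
qed

text \<open>The slacks \<open>b G - n G \<bullet> x\<close> act as coordinates: they are nonnegative
  on \<open>Q\<close>, and the slack of \<open>G\<close> vanishes exactly on \<open>G\<close>. All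
  later geometry is phrased in them.\<close>

locale simple_body =
  fixes Q :: "'a::euclidean_space set" and n :: "'a set \<Rightarrow> 'a" and b :: "'a set \<Rightarrow> real"
  assumes simple: "simple_polytope DIM('a) Q"
    and facet_eq: "\<And>G. G \<in> facets Q \<Longrightarrow> G = {x \<in> Q. n G \<bullet> x = b G}"
    and Q_eq: "Q = {x. \<forall>G \<in> facets Q. n G \<bullet> x \<le> b G}"
begin

lemmas Q_props = simple_polytopeD[OF simple]

lemma mem_Q: "x \<in> Q \<longleftrightarrow> (\<forall>G \<in> facets Q. n G \<bullet> x \<le> b G)"
  using Q_eq by blast

lemma mem_facet: "G \<in> facets Q \<Longrightarrow> x \<in> G \<longleftrightarrow> x \<in> Q \<and> n G \<bullet> x = b G"
  using facet_eq by blast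

text \<open>A slack that is positive at x stays positive for small e, and the slack of a facet
  through x becomes \<open>- e * (n G \<bullet> d)\<close>. As there are finitely many facets, one
  range of e serves them all.\<close>

lemma feasible_direction:
  assumes "x \<in> Q" "\<And>G. G \<in> facets Q \<Longrightarrow> x \<in> G \<Longrightarrow> n G \<bullet> d \<le> 0"
  shows "\<forall>\<^sub>F e in at_right (0::real). x + e *\<^sub>R d \<in> Q \<and>
    (\<forall>G \<in> facets Q. x + e *\<^sub>R d \<in> G \<longleftrightarrow> x \<in> G \<and> n G \<bullet> d = 0)"
proof -
  have ineq: "\<forall>\<^sub>F e in at_right (0::real). n G \<bullet> (x + e *\<^sub>R d) < b G"
    if "G \<in> facets Q" "x \<notin> G" for G
  proof -
    have "((\<lambda>e. n G \<bullet> (x + e *\<^sub>R d)) \<longlongrightarrow> n G \<bullet> (x + 0 *\<^sub>R d)) (at_right (0::real))"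
      by (intro tendsto_intros)
    moreover have "n G \<bullet> (x + 0 *\<^sub>R d) < b G"
      using that assms(1) mem_Q[of x] mem_facet[of G x] by force
    ultimately show ?thesis
      by (rule order_tendstoD)
  qed
  have "\<forall>\<^sub>F e in at_right (0::real). \<forall>G \<in> {G \<in> facets Q. x \<notin> G}. n G \<bullet> (x + e *\<^sub>R d) < b G"
    using ineq Q_props(6) by (intro eventually_ball_finite) auto
  moreover have "\<forall>\<^sub>F e in at_right (0::real). e > 0"
    by (simp add: eventually_at_right_less)
  ultimately show ?thesis
  proof eventually_elim
    case (elim e)
    have *: "n G \<bullet> (x + e *\<^sub>R d) = b G + e * (n G \<bullet> d)" if "G \<in> facets Q" "x \<in> G" for G
      using that mem_facet[of G x] by (simp add: inner_add_right)
    have "n G \<bullet> (x + e *\<^sub>R d) \<le> b G" if "G \<in> facets Q" for G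
    proof (cases "x \<in> G")
      case True
      then show ?thesis
        using * that assms(2)[of G] elim by (simp add: mult_le_0_iff)
    next
      case False
      then show ?thesis using elim that by force
    qed
    then have Q: "x + e *\<^sub>R d \<in> Q"
      by (simp add: mem_Q)
    moreover have "x + e *\<^sub>R d \<in> G \<longleftrightarrow> x \<in> G \<and> n G \<bullet> d = 0" if "G \<in> facets Q" for G
      using elim * that Q mem_facet[OF that, of "x + e *\<^sub>R d"] by (cases "x \<in> G") force+
    ultimately show ?case by blast
  qed
qed

text \<open>Simplicity only speaks of vertices. This carries it to any point x: an extreme point of
  the smallest face cut out by the facets through x lies on all of these facets.\<close>

lemma vertex_above:
  assumes "x \<in> Q"
  obtains w where "{w} face_of Q" "\<forall>G \<in> facets Q. x \<in> G \<longrightarrow> w \<in> G"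
proof -
  \<comment> \<open>The intersection with \<open>Q\<close> covers a point on no facet, where the
    family is empty and the face is all of \<open>Q\<close>.\<close>
  define E where "E = Q \<inter> \<Inter>{G \<in> facets Q. x \<in> G}"
  have "\<Inter>(insert Q {G \<in> facets Q. x \<in> G}) face_of Q"
    using Q_props by (intro face_of_Inter) (auto simp: facets_def facet_of_imp_face_of
        intro: face_of_refl)
  then have E: "E face_of Q"
    by (simp add: E_def)
  have "x \<in> E" using assms by (auto simp: E_def)
  moreover have "polytope E"
    using E Q_props(1) face_of_polytope_polytope by blast
  ultimately obtain w where "w extreme_point_of E"
    by (metis emptyE extreme_point_exists_convex polytope_imp_compact polytope_imp_convex)
  then have w: "{w} face_of E" "w \<in> E"
    by (auto simp: face_of_singleton extreme_point_of_def)
  then have "{w} face_of Q"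
    using E face_of_trans by blast
  then show ?thesis
    using that w by (auto simp: E_def)
qed

text \<open>The direction of the edge that leaves \<open>G\<close> at w. By simplicity the other
  facets at w have at most DIM - 1 normals, so some nonzero d is orthogonal to all of them. Were d
  orthogonal to \<open>n G\<close> as well, both w + e d and w - e d would lie in \<open>Q\<close>
  for small e, although w is a vertex.\<close>

lemma vertex_dual_direction:
  assumes w: "{w} face_of Q" and G: "G \<in> facets Q" "w \<in> G"
  obtains d where "n G \<bullet> d = -1" "\<And>H. H \<in> facets Q \<Longrightarrow> w \<in> H \<Longrightarrow> H \<noteq> G \<Longrightarrow> n H \<bullet> d = 0"
proof -
  define A where "A = {H \<in> facets Q. w \<in> H}"
  have A: "finite A" "card A = DIM('a)"
    using simple w Q_props(6) by (auto simp: A_def simple_polytope_def)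
  have wQ: "w \<in> Q"
    using face_of_imp_subset[OF w] by simp
  have "dim (n ` (A - {G})) \<le> card (n ` (A - {G}))"
    using A by (intro dim_le_card') auto
  also have "\<dots> \<le> card (A - {G})"
    using A by (intro card_image_le) auto
  also have "\<dots> < DIM('a)"
    using A G by (metis A_def DIM_positive card_Diff_singleton diff_less mem_Collect_eq zero_less_one)
  finally have "dim (span (n ` (A - {G}))) < DIM('a)"
    by simp
  then obtain d where d: "d \<noteq> 0" "\<And>y. y \<in> span (n ` (A - {G})) \<Longrightarrow> orthogonal d y"
    using orthogonal_to_subspace_exists by (metis dim_span span_span)
  have d0: "n H \<bullet> d = 0" if "H \<in> facets Q" "w \<in> H" "H \<noteq> G" for H
    using d(2)[of "n H"] that by (auto simp: A_def orthogonal_def inner_commute span_base)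
  have "n G \<bullet> d \<noteq> 0"
  proof
    assume "n G \<bullet> d = 0"
    then have z: "n H \<bullet> d = 0" if "H \<in> facets Q" "w \<in> H" for H
      using d0 that by metis
    have "\<forall>\<^sub>F e in at_right (0::real). w + e *\<^sub>R d \<in> Q"
      using feasible_direction[of w d] z wQ by (auto elim: eventually_mono)
    moreover have "\<forall>\<^sub>F e in at_right (0::real). w + e *\<^sub>R (- d) \<in> Q"
      using feasible_direction[of w "- d"] z wQ by (auto elim: eventually_mono)
    moreover have "\<forall>\<^sub>F e in at_right (0::real). e > 0"
      by (simp add: eventually_at_right_less)
    ultimately have "\<forall>\<^sub>F e in at_right (0::real). e > 0 \<and> w + e *\<^sub>R d \<in> Q \<and> w + e *\<^sub>R (- d) \<in> Q"
      by eventually_elim auto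
    then obtain e :: real where e: "e > 0" "w + e *\<^sub>R d \<in> Q" "w + e *\<^sub>R (- d) \<in> Q"
      using eventually_happens' trivial_limit_at_right_real by blast
    have "w = midpoint (w + e *\<^sub>R d) (w + e *\<^sub>R (- d))"
      by (simp add: midpoint_def algebra_simps flip: scaleR_2)
    moreover have "w + e *\<^sub>R d \<noteq> w + e *\<^sub>R (- d)"
      using e d by (simp add: eq_neg_iff_add_eq_0 flip: scaleR_2)
    ultimately have "w \<in> open_segment (w + e *\<^sub>R d) (w + e *\<^sub>R (- d))"
      by (metis midpoint_in_open_segment)
    then have "w + e *\<^sub>R d \<in> {w}"
      using w e unfolding face_of_def by blast
    then show False
      using e d by simp
  qed
  then show ?thesis
    using that[of "(- 1 / (n G \<bullet> d)) *\<^sub>R d"] d0 by simp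
qed

text \<open>At a vertex above y, add up the edge directions that leave the facets other than
  \<open>T\<close> and \<open>F\<close>. The sum is tangent to \<open>T\<close> and \<open>F\<close>
  and points away from every other facet at that vertex, hence from every other facet at y.\<close>

lemma ridge_generic_direction:
  assumes T: "T \<in> facets Q" "y \<in> T" and F: "F \<in> facets Q" "y \<in> F"
  obtains d where "\<forall>\<^sub>F e in at_right (0::real).
    y + e *\<^sub>R d \<in> T \<and> y + e *\<^sub>R d \<in> F \<and> (\<forall>G \<in> facets Q. y + e *\<^sub>R d \<in> G \<longrightarrow> G = T \<or> G = F)"
proof -
  have y: "y \<in> Q"
    using T Q_props(7) by auto
  obtain w where w: "{w} face_of Q" "\<forall>G \<in> facets Q. y \<in> G \<longrightarrow> w \<in> G"
    using vertex_above[OF y] .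
  have "\<exists>d. n G \<bullet> d = -1 \<and> (\<forall>H \<in> facets Q. w \<in> H \<longrightarrow> H \<noteq> G \<longrightarrow> n H \<bullet> d = 0)"
    if "G \<in> facets Q" "w \<in> G" for G
    using vertex_dual_direction[OF w(1) that] by metis
  then obtain d where d: "\<And>G. G \<in> facets Q \<Longrightarrow> w \<in> G \<Longrightarrow> n G \<bullet> d G = -1"
    "\<And>G H. G \<in> facets Q \<Longrightarrow> w \<in> G \<Longrightarrow> H \<in> facets Q \<Longrightarrow> w \<in> H \<Longrightarrow> H \<noteq> G \<Longrightarrow> n H \<bullet> d G = 0"
    by metis
  define A where "A = {G \<in> facets Q. w \<in> G} - {T, F}"
  define e where "e = (\<Sum>G\<in>A. d G)"
  have fin: "finite A"
    using Q_props(6) by (simp add: A_def)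
  have ne: "n H \<bullet> e = (if H = T \<or> H = F then 0 else -1)" if "H \<in> facets Q" "w \<in> H" for H
  proof -
    have "n H \<bullet> e = (\<Sum>G\<in>A. n H \<bullet> d G)"
      by (simp add: e_def inner_sum_right)
    also have "\<dots> = (\<Sum>G\<in>A. if G = H then -1 else 0)"
      using d that by (intro sum.cong) (auto simp: A_def)
    also have "\<dots> = (if H = T \<or> H = F then 0 else -1)"
      using fin that by (auto simp: A_def sum.delta)
    finally show ?thesis .
  qed
  have "\<forall>\<^sub>F t in at_right (0::real). y + t *\<^sub>R e \<in> Q \<and>
    (\<forall>G \<in> facets Q. y + t *\<^sub>R e \<in> G \<longleftrightarrow> y \<in> G \<and> n G \<bullet> e = 0)"
    using ne w by (intro feasible_direction) (auto simp: y)
  then have "\<forall>\<^sub>F t in at_right (0::real).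
    y + t *\<^sub>R e \<in> T \<and> y + t *\<^sub>R e \<in> F \<and> (\<forall>G \<in> facets Q. y + t *\<^sub>R e \<in> G \<longrightarrow> G = T \<or> G = F)"
  proof eventually_elim
    case (elim t)
    show ?case
      using elim ne w T F by (smt (verit, best))
  qed
  then show ?thesis using that by blast
qed

end


subsection \<open>Collars of facets\<close>

context simple_body
begin

text \<open>The edge directions \<open>d w\<close> leaving \<open>T\<close> at its vertices are
  averaged with weights \<open>\<phi> w\<close>, the products of the slacks of the facets that miss
  w. For another facet \<open>G\<close>, a vertex on \<open>G\<close> contributes nothing to
  \<open>n G \<bullet> D x\<close>, and a vertex off \<open>G\<close> has the slack of
  \<open>G\<close> as a factor of its weight. So the whole expression is that slack times a bounded
  function. The weights have a positive sum because a vertex above x has positive weight.\<close>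

lemma transversal_field:
  assumes T: "T \<in> facets Q"
  obtains D :: "'a \<Rightarrow> 'a" and C L :: real
  where "L-lipschitz_on T D" "\<forall>x \<in> T. n T \<bullet> D x = -1" "C \<ge> 0"
    "\<forall>G \<in> facets Q - {T}. \<forall>x \<in> T. \<exists>r. \<bar>r\<bar> \<le> C \<and> n G \<bullet> D x = (b G - n G \<bullet> x) * r"
proof -
  have TQ: "T \<subseteq> Q" "compact T"
  proof -
    show "T \<subseteq> Q"
      using T Q_props(7) by blast
    then show "compact T"
      using T Q_props(2,8) by (metis closed_Int_compact inf.absorb1)
  qed
  define s where "s G x = b G - n G \<bullet> x" for G x
  have s_nonneg: "s G x \<ge> 0" if "G \<in> facets Q" "x \<in> Q" for G x
    using that mem_Q by (simp add: s_def)
  have s_zero: "s G x = 0 \<longleftrightarrow> x \<in> G" if "G \<in> facets Q" "x \<in> Q" for G x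
    using that mem_facet by (auto simp: s_def)
  have s_lip: "\<exists>L. L-lipschitz_on T (s G)" for G
  proof -
    have "(norm (n G))-lipschitz_on T (s G)"
    proof (rule lipschitz_onI)
      fix x y
      have "dist (s G x) (s G y) = \<bar>n G \<bullet> (x - y)\<bar>"
        by (simp add: s_def dist_real_def inner_diff_right abs_minus_commute)
      also have "\<dots> \<le> norm (n G) * dist x y"
        by (simp add: Cauchy_Schwarz_ineq2 dist_norm)
      finally show "dist (s G x) (s G y) \<le> norm (n G) * dist x y" .
    qed auto
    then show ?thesis ..
  qed
  define W where "W = {w \<in> T. {w} face_of Q}"
  have "finite {w. w extreme_point_of Q}"
    using Q_props(4) finite_polyhedron_extreme_points by blast
  then have W: "finite W"
    by (rule finite_subset[rotated]) (auto simp: W_def face_of_singleton)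
  have "\<forall>w \<in> W. \<exists>d. n T \<bullet> d = -1 \<and> (\<forall>H \<in> facets Q. w \<in> H \<longrightarrow> H \<noteq> T \<longrightarrow> n H \<bullet> d = 0)"
    using vertex_dual_direction[OF _ T] unfolding W_def by (metis (no_types, lifting) mem_Collect_eq)
  from bchoice[OF this] obtain d where d: "\<And>w. w \<in> W \<Longrightarrow> n T \<bullet> d w = -1"
    "\<And>w H. w \<in> W \<Longrightarrow> H \<in> facets Q \<Longrightarrow> w \<in> H \<Longrightarrow> H \<noteq> T \<Longrightarrow> n H \<bullet> d w = 0"
    by blast
  define \<phi> where "\<phi> w x = (\<Prod>G \<in> {G \<in> facets Q. w \<notin> G}. s G x)" for w x
  define \<Phi> where "\<Phi> x = (\<Sum>w\<in>W. \<phi> w x)" for x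
  define D where "D x = inverse (\<Phi> x) *\<^sub>R (\<Sum>w\<in>W. \<phi> w x *\<^sub>R d w)" for x
  have \<phi>_nonneg: "\<phi> w x \<ge> 0" if "x \<in> T" for w x
    using that TQ s_nonneg by (auto simp: \<phi>_def intro!: prod_nonneg)
  have \<Phi>_pos: "\<Phi> x > 0" if "x \<in> T" for x
  proof -
    have "x \<in> Q" using that TQ by blast
    then obtain w where w: "{w} face_of Q" "\<forall>G \<in> facets Q. x \<in> G \<longrightarrow> w \<in> G"
      by (rule vertex_above)
    have wW: "w \<in> W"
      using w T that by (auto simp: W_def)
    have "s G x > 0" if "G \<in> facets Q" "w \<notin> G" for G
      using w(2) that s_zero[of G x] s_nonneg[of G x] TQ \<open>x \<in> T\<close> by force
    then have "\<phi> w x > 0"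
      by (auto simp: \<phi>_def intro!: prod_pos)
    then show ?thesis
      using W wW \<phi>_nonneg[OF that] unfolding \<Phi>_def by (intro sum_pos2[of W w]) auto
  qed
  have \<phi>_lip: "\<exists>L. L-lipschitz_on T (\<phi> w)" for w
    unfolding \<phi>_def using Q_props(6) TQ(2) s_lip by (intro lipschitz_prod) auto
  have \<Phi>_lip: "\<exists>L. L-lipschitz_on T \<Phi>"
    unfolding \<Phi>_def using W \<phi>_lip by (intro lipschitz_sum) auto
  then have i\<Phi>_lip: "\<exists>L. L-lipschitz_on T (\<lambda>x. inverse (\<Phi> x))"
    using lipschitz_inverse[OF TQ(2)] \<Phi>_pos by blast
  have "\<exists>L. L-lipschitz_on T (\<lambda>x. \<phi> w x *\<^sub>R d w)" for w
    using \<phi>_lip[of w] lipschitz_scaleR[OF TQ(2) _ lipschitz_on_constant] by blast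
  then have "\<exists>L. L-lipschitz_on T (\<lambda>x. \<Sum>w\<in>W. \<phi> w x *\<^sub>R d w)"
    using W by (intro lipschitz_sum) auto
  then have "\<exists>L. L-lipschitz_on T D"
    unfolding D_def using i\<Phi>_lip lipschitz_scaleR[OF TQ(2)] by blast
  then obtain L where L: "L-lipschitz_on T D" ..
  have DT: "n T \<bullet> D x = -1" if "x \<in> T" for x
  proof -
    have "n T \<bullet> D x = inverse (\<Phi> x) * (\<Sum>w\<in>W. \<phi> w x * (n T \<bullet> d w))"
      by (simp add: D_def inner_sum_right)
    also have "(\<Sum>w\<in>W. \<phi> w x * (n T \<bullet> d w)) = - \<Phi> x"
      using d by (simp add: \<Phi>_def sum_negf)
    finally show ?thesis
      using \<Phi>_pos[OF that] by simp
  qed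
  \<comment> \<open>The quotient of \<open>n G \<bullet> D x\<close> by the slack of
    \<open>G\<close>, with that factor cancelled beforehand; it is therefore continuous, and so
    bounded, also where the slack vanishes.\<close>
  define R where "R G x = inverse (\<Phi> x) *
      (\<Sum>w \<in> {w \<in> W. w \<notin> G}. (\<Prod>H \<in> {H \<in> facets Q. w \<notin> H} - {G}. s H x) * (n G \<bullet> d w))" for G x
  have DG: "n G \<bullet> D x = s G x * R G x" if "G \<in> facets Q" "G \<noteq> T" "x \<in> T" for G x
  proof -
    have "(\<Sum>w\<in>W. \<phi> w x * (n G \<bullet> d w)) = (\<Sum>w \<in> {w \<in> W. w \<notin> G}. \<phi> w x * (n G \<bullet> d w))"
      using W d(2) that by (intro sum.mono_neutral_right) auto
    also have "\<dots> = (\<Sum>w \<in> {w \<in> W. w \<notin> G}.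
        s G x * ((\<Prod>H \<in> {H \<in> facets Q. w \<notin> H} - {G}. s H x) * (n G \<bullet> d w)))"
      using Q_props(6) that
      by (intro sum.cong) (auto simp: \<phi>_def prod.remove[of "{H \<in> facets Q. _ \<notin> H}" G])
    finally show ?thesis
      by (simp add: D_def R_def inner_sum_right flip: sum_distrib_left)
  qed
  have s_cont: "continuous_on T (s G)" for G
    unfolding s_def by (intro continuous_intros)
  have \<Phi>_cont: "continuous_on T \<Phi>"
    using \<Phi>_lip lipschitz_on_continuous_on by blast
  have "continuous_on T (R G)" for G
    unfolding R_def using \<Phi>_pos
    by (intro continuous_intros s_cont \<Phi>_cont continuous_on_inverse) force
  then have "bounded (R G ` T)" for G
    using TQ(2) by (meson compact_continuous_image compact_imp_bounded)
  then have "bounded (\<Union>G \<in> facets Q. R G ` T)"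
    using Q_props(6) by (intro bounded_UN) auto
  then obtain C where C: "C > 0" "\<And>y. y \<in> (\<Union>G \<in> facets Q. R G ` T) \<Longrightarrow> \<bar>y\<bar> \<le> C"
    unfolding bounded_pos by auto
  show ?thesis
  proof (rule that[OF L])
    show "\<forall>x \<in> T. n T \<bullet> D x = -1" using DT by blast
    show "C \<ge> 0" using C by simp
    show "\<forall>G \<in> facets Q - {T}. \<forall>x \<in> T. \<exists>r. \<bar>r\<bar> \<le> C \<and> n G \<bullet> D x = (b G - n G \<bullet> x) * r"
    proof (intro ballI)
      fix G x assume G: "G \<in> facets Q - {T}" and x: "x \<in> T"
      then have "\<bar>R G x\<bar> \<le> C"
        using C(2) by blast
      moreover have "n G \<bullet> D x = (b G - n G \<bullet> x) * R G x"
        using DG[of G x] G x by (simp add: s_def)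
      ultimately show "\<exists>r. \<bar>r\<bar> \<le> C \<and> n G \<bullet> D x = (b G - n G \<bullet> x) * r"
        by blast
    qed
  qed
qed

text \<open>
  The collar pushes T inwards along a Lipschitz field tangent to all other facets. Surjectivity onto
  a neighbourhood of T is Brouwer's theorem for x \<mapsto> closest point of T to y - tD(x): at a fixed
  point x the residual y - x - tD(x) is both normal to T at x and a feasible direction.
\<close>

lemma facet_collar:
  assumes T: "T \<in> facets Q"
  obtains c :: "'a \<times> real \<Rightarrow> 'a"
  where "continuous_on (T \<times> {0..1}) c" "inj_on c (T \<times> {0..1})" "c ` (T \<times> {0..1}) \<subseteq> Q"
    "\<And>x. x \<in> T \<Longrightarrow> c (x, 0) = x"
    "\<And>G x t. G \<in> facets Q \<Longrightarrow> G \<noteq> T \<Longrightarrow> x \<in> T \<Longrightarrow> t \<in> {0..1} \<Longrightarrow> c (x, t) \<in> G \<longleftrightarrow> x \<in> G"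
    "openin (top_of_set Q) (c ` (T \<times> {0..<1}))"
proof -
  obtain L D C where L: "L-lipschitz_on T D" and D: "\<forall>x \<in> T. n T \<bullet> D x = -1"
    and C: "C \<ge> 0" and R: "\<forall>G \<in> facets Q - {T}. \<forall>x \<in> T.
      \<exists>r. \<bar>r\<bar> \<le> C \<and> n G \<bullet> D x = (b G - n G \<bullet> x) * r"
    using transversal_field[OF T] .
  have DT: "n T \<bullet> D x = -1" if "x \<in> T" for x
    using D that by blast
  have DG: "\<exists>r. \<bar>r\<bar> \<le> C \<and> n G \<bullet> D x = (b G - n G \<bullet> x) * r"
    if "G \<in> facets Q" "G \<noteq> T" "x \<in> T" for G x
    using R that by blast
  have L0: "L \<ge> 0"
    using L lipschitz_on_nonneg by blast
  have TQ: "T \<subseteq> Q" "closed T" "T \<noteq> {}" "convex T"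
    using T Q_props by (auto simp: facets_def facet_of_def face_of_imp_convex)
  have "compact T"
    using TQ Q_props(2) by (metis closed_Int_compact inf.absorb1)
  \<comment> \<open>Small against both constants: \<open>\<epsilon> * L < 1\<close> makes the flow
    injective on each level, and \<open>\<epsilon> * C < 1\<close> makes it rescale the slack of
    every facet other than \<open>T\<close> by a positive factor, so such facets are neither entered
    nor left.\<close>
  define \<epsilon> where "\<epsilon> = 1 / (L + C + 1)"
  have \<epsilon>: "\<epsilon> > 0" "\<epsilon> * L < 1" "\<epsilon> * C < 1"
    using L0 C by (auto simp: \<epsilon>_def field_simps)
  define c where "c = (\<lambda>(x, t). x + (\<epsilon> * t) *\<^sub>R D x)"
  have Dcont: "continuous_on T D"
    using L lipschitz_on_continuous_on by blast
  have cont: "continuous_on (T \<times> {0..1}) c"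
    unfolding c_def case_prod_unfold
    by (intro continuous_intros continuous_on_compose2[OF Dcont]) auto
  have cT: "n T \<bullet> c (x, t) = b T - \<epsilon> * t" if "x \<in> T" for x t
    using DT[OF that] mem_facet[OF T, of x] that by (simp add: c_def inner_add_right)
  have cG: "\<exists>r > 0. b G - n G \<bullet> c (x, t) = r * (b G - n G \<bullet> x)"
    if G: "G \<in> facets Q" "G \<noteq> T" and x: "x \<in> T" and t: "t \<in> {0..1}" for G x t
  proof -
    obtain r where r: "\<bar>r\<bar> \<le> C" "n G \<bullet> D x = (b G - n G \<bullet> x) * r"
      using DG[OF G x] by blast
    have "\<bar>\<epsilon> * t * r\<bar> = \<epsilon> * (t * \<bar>r\<bar>)"
      using \<epsilon> t by (simp add: abs_mult)
    also have "\<dots> \<le> \<epsilon> * (1 * C)"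
      using \<epsilon> t r by (intro mult_left_mono mult_mono) auto
    finally have "1 - \<epsilon> * t * r > 0"
      using \<epsilon> by linarith
    moreover have "b G - n G \<bullet> c (x, t) = (1 - \<epsilon> * t * r) * (b G - n G \<bullet> x)"
      by (simp add: c_def inner_add_right r(2)) (simp add: algebra_simps)
    ultimately show ?thesis by blast
  qed
  have cQ: "c (x, t) \<in> Q" if x: "x \<in> T" and t: "t \<in> {0..1}" for x t
    unfolding mem_Q
  proof
    fix G assume G: "G \<in> facets Q"
    show "n G \<bullet> c (x, t) \<le> b G"
    proof (cases "G = T")
      case True
      then show ?thesis using cT[OF x, of t] \<epsilon> t by simp
    next
      case False
      obtain r where r: "r > 0" "b G - n G \<bullet> c (x, t) = r * (b G - n G \<bullet> x)"
        using cG[OF G False x t] by blast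
      moreover have "b G - n G \<bullet> x \<ge> 0"
        using x TQ G mem_Q by auto
      ultimately have "b G - n G \<bullet> c (x, t) \<ge> 0"
        by simp
      then show ?thesis by simp
    qed
  qed
  have inj: "inj_on c (T \<times> {0..1})"
  proof (rule inj_onI, clarsimp)
    fix x t y u assume x: "x \<in> T" "0 \<le> t" "t \<le> (1::real)" and y: "y \<in> T" "0 \<le> u" "u \<le> (1::real)"
      and eq: "c (x, t) = c (y, u)"
    have tu: "t = u"
      using cT[OF x(1), of t] cT[OF y(1), of u] eq \<epsilon> by simp
    have "x - y = (\<epsilon> * t) *\<^sub>R (D y - D x)"
      using eq tu by (simp add: c_def algebra_simps)
    then have "dist x y = \<epsilon> * t * dist (D x) (D y)"
      using \<epsilon> x by (simp add: dist_norm norm_minus_commute)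
    also have "\<dots> \<le> \<epsilon> * 1 * (L * dist x y)"
      using \<epsilon> x lipschitz_onD[OF L x(1) y(1)] L0 by (intro mult_mono) auto
    finally have "(1 - \<epsilon> * L) * dist x y \<le> 0"
      by (simp add: algebra_simps)
    then have "x = y"
      using \<epsilon> by (simp add: mult_le_0_iff)
    then show "x = y \<and> t = u"
      using tu by simp
  qed
  have onto: "\<exists>x \<in> T. y = c (x, t)" if y: "y \<in> Q" and t: "t \<in> {0..1}" and yt: "n T \<bullet> y = b T - \<epsilon> * t" for y t
  proof -
    define u where "u x = y - (\<epsilon> * t) *\<^sub>R D x" for x
    have "continuous_on T (\<lambda>x. closest_point T (u x))"
      unfolding u_def using TQ
      by (intro continuous_on_compose2[OF continuous_on_closest_point[of T UNIV]]
          continuous_intros Dcont) auto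
    moreover have "(\<lambda>x. closest_point T (u x)) \<in> T \<rightarrow> T"
      using TQ by (simp add: closest_point_in_set)
    ultimately obtain x where x: "x \<in> T" "closest_point T (u x) = x"
      using brouwer[OF \<open>compact T\<close> TQ(4,3)] by blast
    have xQ: "x \<in> Q" using x TQ by auto
    define r where "r = u x - x"
    have r: "r = y - c (x, t)"
      by (simp add: r_def u_def c_def)
    have rT: "n T \<bullet> r = 0"
      using yt cT[OF x(1), of t] by (simp add: r inner_diff_right)
    have rG: "n G \<bullet> r \<le> 0" if G: "G \<in> facets Q" "x \<in> G" for G
    proof (cases "G = T")
      case True
      then show ?thesis using rT by simp
    next
      case False
      have "b G - n G \<bullet> x = 0"
        using G mem_facet by auto
      then have "n G \<bullet> c (x, t) = b G"
        using cG[OF G(1) False x(1) t] by auto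
      then show ?thesis
        using y mem_Q[of y] G by (simp add: r inner_diff_right)
    qed
    have "\<forall>\<^sub>F e in at_right (0::real). x + e *\<^sub>R r \<in> T"
      using feasible_direction[OF xQ rG] T rT x by (auto elim: eventually_mono)
    moreover have "\<forall>\<^sub>F e in at_right (0::real). e > 0"
      by (simp add: eventually_at_right_less)
    ultimately have "\<forall>\<^sub>F e in at_right (0::real). e > 0 \<and> x + e *\<^sub>R r \<in> T"
      by eventually_elim auto
    then obtain e :: real where e: "e > 0" "x + e *\<^sub>R r \<in> T"
      using eventually_happens' trivial_limit_at_right_real by blast
    have "(u x - closest_point T (u x)) \<bullet> (x + e *\<^sub>R r - closest_point T (u x)) \<le> 0"
      using TQ e by (intro closest_point_dot) auto
    then have "e * (r \<bullet> r) \<le> 0"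
      using x by (simp add: r_def)
    then have "r \<bullet> r \<le> 0"
      using e by (simp add: mult_le_0_iff)
    then have "r = 0"
      by (metis inner_ge_zero inner_eq_zero_iff order_antisym)
    then show ?thesis
      using r x by auto
  qed
  \<comment> \<open>The slack of \<open>T\<close> at \<open>c (x, t)\<close> is
    \<open>\<epsilon> * t\<close>. The half-open collar is thus the slab where this slack is below
    \<open>\<epsilon>\<close>, which is relatively open.\<close>
  have "c ` (T \<times> {0..<1}) = Q \<inter> {y. n T \<bullet> y > b T - \<epsilon>}"
  proof (intro equalityI subsetI)
    fix y assume "y \<in> c ` (T \<times> {0..<1})"
    then show "y \<in> Q \<inter> {y. n T \<bullet> y > b T - \<epsilon>}"
      using cQ cT \<epsilon> by auto
  next
    fix y assume y: "y \<in> Q \<inter> {y. n T \<bullet> y > b T - \<epsilon>}"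
    define t where "t = (b T - n T \<bullet> y) / \<epsilon>"
    have "n T \<bullet> y \<le> b T"
      using y T mem_Q by auto
    then have t: "0 \<le> t" "t < 1"
      using y \<epsilon> by (auto simp: t_def)
    moreover have "n T \<bullet> y = b T - \<epsilon> * t"
      using \<epsilon> by (simp add: t_def)
    ultimately obtain x where "x \<in> T" "y = c (x, t)"
      using onto[of y t] y by auto
    then show "y \<in> c ` (T \<times> {0..<1})"
      using t by auto
  qed
  moreover have "open {y. n T \<bullet> y > b T - \<epsilon>}"
    by (rule open_halfspace_gt)
  ultimately have ope: "openin (top_of_set Q) (c ` (T \<times> {0..<1}))"
    by (simp add: openin_open_Int)
  show ?thesis
  proof (rule that[OF cont inj _ _ _ ope])
    show "c ` (T \<times> {0..1}) \<subseteq> Q"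
      using cQ by auto
    show "c (x, 0) = x" for x
      by (simp add: c_def)
    show "c (x, t) \<in> G \<longleftrightarrow> x \<in> G"
      if "G \<in> facets Q" "G \<noteq> T" "x \<in> T" "t \<in> {0..1}" for G x t
    proof -
      obtain r where "r > 0" "b G - n G \<bullet> c (x, t) = r * (b G - n G \<bullet> x)"
        using cG \<open>G \<in> facets Q\<close> \<open>G \<noteq> T\<close> \<open>x \<in> T\<close> \<open>t \<in> {0..1}\<close> by blast
      then have "n G \<bullet> c (x, t) = b G \<longleftrightarrow> n G \<bullet> x = b G"
        by (metis eq_iff_diff_eq_0 mult_eq_0_iff less_irrefl)
      then show ?thesis
        using that cQ TQ mem_facet by blast
    qed
  qed
qed

end


subsection \<open>Glued spaces as quotients\<close>

text \<open>With finitely many colors the discrete factor of \<open>cells\<close> is compact, and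
  saturations become finite unions.\<close>

instance bit :: finite
proof
  have "(UNIV :: bit set) = {0, 1}"
    by auto
  then show "finite (UNIV :: bit set)"
    by (metis finite.emptyI finite.insertI)
qed

lemma vec_bit_add_self: "v + v = (0 :: bit ^ 'n)"
  by (simp add: vec_eq_iff)

text \<open>The stabiliser, under translation of colors, of the points of the glued space that lie
  over p. All questions about fibres are reduced to this subgroup.\<close>

definition local_span ::
    "'a::euclidean_space set \<Rightarrow> ('a set \<Rightarrow> bit ^ 'n) \<Rightarrow> 'a \<Rightarrow> (bit ^ 'n) set" where
  "local_span Q c p = vec.span (c ` {F \<in> facets Q. p \<in> F})"

lemma glue_step_colors:
  "glue_step Q c (p, v) y \<longleftrightarrow> (\<exists>u \<in> c ` {F \<in> facets Q. p \<in> F}. y = (p, v + u))"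
  by (auto simp: glue_step_def)

text \<open>Adding a color twice does nothing, so every step is reversible by a step of the same
  kind, and chains from (p, v) add sums of colors of facets through p. With scalars 0 and 1 these
  sums form the span; v + w stands for the difference of v and w.\<close>

lemma equivclp_glue_step_iff:
  "equivclp (glue_step Q c) (p, v) (p', w) \<longleftrightarrow> p = p' \<and> v + w \<in> local_span Q c p"
proof
  have sub: "y \<in> {(p, w) | w. v + w \<in> local_span Q c p}"
    if "equivclp (glue_step Q c) (p, v) y" for y
    using that
  proof (induction rule: equivclp_induct)
    case base
    then show ?case
      by (simp add: vec_bit_add_self local_span_def vec.span_zero)
  next
    case (step y z)
    then obtain w where w: "y = (p, w)" "v + w \<in> local_span Q c p"
      by blast
    obtain q b where qb: "z = (q, b)"
      by (cases z)
    have "\<exists>u \<in> c ` {F \<in> facets Q. p \<in> F}. z = (p, w + u)"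
      using step(2)
    proof
      assume "glue_step Q c y z"
      then show ?thesis
        by (simp add: w glue_step_colors)
    next
      assume "glue_step Q c z y"
      then have "\<exists>u \<in> c ` {F \<in> facets Q. q \<in> F}. p = q \<and> w = b + u"
        unfolding w qb glue_step_colors by simp
      then obtain u where u: "u \<in> c ` {F \<in> facets Q. p \<in> F}" and "q = p" "w = b + u"
        by blast
      then have "z = (p, w + u)"
        by (simp add: qb add.assoc vec_bit_add_self)
      then show ?thesis
        using u by blast
    qed
    then obtain u where u: "u \<in> c ` {F \<in> facets Q. p \<in> F}" and "z = (p, w + u)"
      by blast
    moreover have "v + w + u \<in> local_span Q c p"
      using vec.span_add[OF w(2)[unfolded local_span_def] vec.span_base[OF u]]
      by (simp add: local_span_def)
    ultimately show ?case
      by (simp add: add.assoc)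
  qed
  then show "p = p' \<and> v + w \<in> local_span Q c p" if "equivclp (glue_step Q c) (p, v) (p', w)"
    using that by blast
next
  have "equivclp (glue_step Q c) (p, v) (p, v + u)" if "u \<in> local_span Q c p" for u
    using that unfolding local_span_def
  proof (induction rule: vec.span_induct_alt)
    case base
    then show ?case by simp
  next
    case (step k x y)
    have "glue_step Q c (p, v + y) (p, v + y + x)"
      unfolding glue_step_colors using step(1) by blast
    then have "equivclp (glue_step Q c) (p, v) (p, v + y + x)"
      using step(2) by (rule equivclp_trans[OF _ r_into_equivclp, rotated])
    moreover have "k *s x + y = (if k = 0 then y else y + x)"
      by (auto simp: vec_eq_iff add.commute)
    ultimately show ?case
      using step(2) by (simp add: add.assoc)
  qed
  from this[of "v + w"]
  show "equivclp (glue_step Q c) (p, v) (p', w)" if "p = p' \<and> v + w \<in> local_span Q c p"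
    using that unfolding add.assoc[symmetric] vec_bit_add_self by (metis add_0)
qed

lemma glue_class_eq_iff:
  "glue_class Q c (p, v) = glue_class Q c (p', w) \<longleftrightarrow> p = p' \<and> v + w \<in> local_span Q c p"
proof -
  have "glue_class Q c x = glue_class Q c y \<longleftrightarrow> equivclp (glue_step Q c) x y" for x y
    unfolding glue_class_def by (smt (verit) Collect_cong equivclp_sym equivclp_trans
        equivclp_refl mem_Collect_eq)
  then show ?thesis
    by (simp add: equivclp_glue_step_iff)
qed

abbreviation cells :: "'a::euclidean_space set \<Rightarrow> ('a \<times> (bit ^ 'n)) topology" where
  "cells Q \<equiv> prod_topology (top_of_set Q) (discrete_topology UNIV)"

section \<open>Continuity, compactness and separation for the quotient\<close>

lemma continuous_map_from_prod_discrete: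
  assumes "\<And>v. v \<in> V \<Longrightarrow> continuous_map X Y (\<lambda>x. f (x, v))"
  shows "continuous_map (prod_topology X (discrete_topology V)) Y f"
  unfolding continuous_map_def
proof (intro conjI allI impI)
  show "f \<in> topspace (prod_topology X (discrete_topology V)) \<rightarrow> topspace Y"
    using assms by (fastforce simp: continuous_map_def)
next
  fix U assume "openin Y U"
  then have "openin X {x \<in> topspace X. f (x, v) \<in> U}" if "v \<in> V" for v
    using assms[OF that] by (simp add: continuous_map_def)
  then have "openin (prod_topology X (discrete_topology V))
      (\<Union>v\<in>V. {x \<in> topspace X. f (x, v) \<in> U} \<times> {v})"
    by (intro openin_Union) (auto simp: openin_prod_Times_iff)
  moreover have "{x \<in> topspace (prod_topology X (discrete_topology V)). f x \<in> U} =
      (\<Union>v\<in>V. {x \<in> topspace X. f (x, v) \<in> U} \<times> {v})"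
    by auto
  ultimately show "openin (prod_topology X (discrete_topology V))
      {x \<in> topspace (prod_topology X (discrete_topology V)). f x \<in> U}"
    by simp
qed

lemma quotient_map_glue_class: "quotient_map (cells Q) (glued_space Q c) (glue_class Q c)"
  by (simp add: glued_space_def quotient_map_quotient_top)

lemma continuous_map_glue_class: "continuous_map (cells Q) (glued_space Q c) (glue_class Q c)"
  using quotient_map_glue_class quotient_imp_continuous_map by blast

lemma topspace_glued_space: "topspace (glued_space Q c) = glue_class Q c ` (Q \<times> UNIV)"
  by (simp add: glued_space_def)

text \<open>The saturation of K is described by \<open>local_span\<close>, which jumps from point to
  point. Indexing by families of facets and pairs of colors instead writes it as a finite union of
  closed sets: a point in all members of a family has at least the span of that family, and the
  family of all facets through the point attains its local span.\<close>

lemma closed_map_glue_class: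
  fixes c :: "'a::euclidean_space set \<Rightarrow> bit ^ 'n"
  assumes "finite (facets Q)" and clo: "\<And>F. F \<in> facets Q \<Longrightarrow> closed F"
  shows "closed_map (cells Q) (glued_space Q c) (glue_class Q c)"
  unfolding closed_map_def
proof (intro allI impI)
  fix K :: "('a \<times> (bit ^ 'n)) set"
  assume K: "closedin (cells Q) K"
  then have KQ: "K \<subseteq> Q \<times> UNIV"
    using closedin_subset by fastforce
  define Kv where "Kv v = {p \<in> Q. (p, v) \<in> K}" for v
  have Kv: "closedin (top_of_set Q) (Kv v)" for v
  proof -
    have "continuous_map (top_of_set Q) (cells Q) (\<lambda>p. (p, v))"
      by (simp add: continuous_map_paired)
    from closedin_continuous_map_preimage[OF this K] show ?thesis
      by (simp add: Kv_def)
  qed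
  have "{x \<in> topspace (cells Q). glue_class Q c x \<in> glue_class Q c ` K} =
      (\<Union>(\<F>, v, w) \<in> {(\<F>, v, w). \<F> \<subseteq> facets Q \<and> v + w \<in> vec.span (c ` \<F>)}.
        (Kv v \<inter> \<Inter>\<F>) \<times> {w})" (is "?L = ?R")
  proof (intro equalityI subsetI)
    fix x assume x: "x \<in> ?L"
    obtain p w where pw: "x = (p, w)" by (cases x)
    obtain v where v: "(p, v) \<in> K" "v + w \<in> local_span Q c p"
      using x by (auto simp: pw glue_class_eq_iff add.commute)
    then show "x \<in> ?R"
      using x by (intro UN_I[of "({F \<in> facets Q. p \<in> F}, v, w)"])
        (auto simp: pw local_span_def Kv_def)
  next
    fix x assume "x \<in> ?R"
    then obtain p \<F> v w where x: "x = (p, w)" "(p, v) \<in> K" "p \<in> Q"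
      and \<F>: "\<F> \<subseteq> facets Q" "p \<in> \<Inter>\<F>" and "v + w \<in> vec.span (c ` \<F>)"
      by (auto simp: Kv_def)
    moreover have "vec.span (c ` \<F>) \<subseteq> local_span Q c p"
      unfolding local_span_def using \<F> by (intro vec.span_mono) auto
    ultimately have "glue_class Q c x = glue_class Q c (p, v)"
      by (auto simp: glue_class_eq_iff add.commute)
    then show "x \<in> ?L"
      using x by auto
  qed
  moreover have "closedin (cells Q) ?R"
  proof (intro closedin_Union)
    have "finite (Pow (facets Q) \<times> (UNIV :: ((bit ^ 'n) \<times> (bit ^ 'n)) set))"
      using assms(1) by simp
    then have "finite {(\<F>, v :: bit ^ 'n, w :: bit ^ 'n). \<F> \<subseteq> facets Q \<and> v + w \<in> vec.span (c ` \<F>)}"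
      by (rule finite_subset[rotated]) auto
    then show "finite ((\<lambda>(\<F>, v, w). (Kv v \<inter> \<Inter>\<F>) \<times> {w}) `
        {(\<F>, v, w). \<F> \<subseteq> facets Q \<and> v + w \<in> vec.span (c ` \<F>)})"
      by (rule finite_imageI)
  next
    fix A assume "A \<in> (\<lambda>(\<F>, v, w). (Kv v \<inter> \<Inter>\<F>) \<times> {w}) `
        {(\<F>, v, w). \<F> \<subseteq> facets Q \<and> v + w \<in> vec.span (c ` \<F>)}"
    then obtain \<F> v w where A: "A = (Kv v \<inter> \<Inter>\<F>) \<times> {w}" "\<F> \<subseteq> facets Q"
      by auto
    have "closed (\<Inter>\<F>)"
      using A clo by (intro closed_Inter) auto
    then have "closedin (top_of_set Q) (Kv v \<inter> (Q \<inter> \<Inter>\<F>))"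
      using Kv by (intro closedin_Int closedin_closed_Int)
    moreover have "Kv v \<inter> (Q \<inter> \<Inter>\<F>) = Kv v \<inter> \<Inter>\<F>"
      by (auto simp: Kv_def)
    ultimately have "closedin (top_of_set Q) (Kv v \<inter> \<Inter>\<F>)"
      by simp
    then show "closedin (cells Q) A"
      by (simp add: A closedin_prod_Times_iff)
  qed
  ultimately have "closedin (cells Q) {x \<in> topspace (cells Q). glue_class Q c x \<in> glue_class Q c ` K}"
    by simp
  moreover have "glue_class Q c ` K \<subseteq> topspace (glued_space Q c)"
    unfolding topspace_glued_space using KQ by (rule image_mono)
  ultimately show "closedin (glued_space Q c) (glue_class Q c ` K)"
    using quotient_map_glue_class[of Q c] by (simp add: quotient_map_closedin)
qed

lemma compact_glued_space:
  assumes "compact Q"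
  shows "compact_space (cells Q :: ('a::euclidean_space \<times> (bit ^ 'n)) topology)"
    and "compact_space (glued_space Q (c :: 'a set \<Rightarrow> bit ^ 'n))"
proof -
  show *: "compact_space (cells Q :: ('a \<times> (bit ^ 'n)) topology)"
    using assms by (simp add: compact_space_prod_topology compact_space_subtopology
        compact_space_discrete_topology)
  then show "compact_space (glued_space Q c)"
    using image_compactin[OF _ continuous_map_glue_class[of Q c]]
    by (auto simp: compact_space_def topspace_glued_space)
qed

text \<open>The compact Hausdorff space \<open>cells Q\<close> is normal, and a closed continuous
  surjection preserves being normal and Hausdorff.\<close>

lemma Hausdorff_glued_space:
  fixes c :: "'a::euclidean_space set \<Rightarrow> bit ^ 'n"
  assumes "compact Q" "finite (facets Q)" "\<And>F. F \<in> facets Q \<Longrightarrow> closed F"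
  shows "Hausdorff_space (glued_space Q c)"
proof -
  have H: "Hausdorff_space (cells Q :: ('a \<times> (bit ^ 'n)) topology)"
    by (simp add: Hausdorff_space_prod_topology Hausdorff_space_subtopology)
  then have "normal_space (cells Q :: ('a \<times> (bit ^ 'n)) topology)"
    using compact_glued_space(1)[OF assms(1)] compact_Hausdorff_or_regular_imp_normal_space by blast
  then show ?thesis
    using H closed_map_glue_class[OF assms(2,3)] continuous_map_glue_class
      normal_Hausdorff_space_closed_continuous_map_image topspace_glued_space
    by (metis (no_types, lifting) quotient_imp_surjective_map quotient_map_glue_class)
qed

text \<open>The fibre condition makes f descend to an injective map on the quotient, and a
  continuous bijection from a compact space to a Hausdorff space is a homeomorphism.\<close>

lemma homeomorphic_glued_spaceI:
  fixes c :: "'a::euclidean_space set \<Rightarrow> bit ^ 'n"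
  assumes Q: "compact Q" and H: "Hausdorff_space Y"
    and f: "continuous_map (cells Q) Y f" "f ` (Q \<times> UNIV) = topspace Y"
    and eq: "\<And>p v p' w. p \<in> Q \<Longrightarrow> p' \<in> Q \<Longrightarrow>
      f (p, v) = f (p', w) \<longleftrightarrow> p = p' \<and> v + w \<in> local_span Q c p"
  shows "glued_space Q c homeomorphic_space Y"
proof -
  have ff: "f x = f y \<longleftrightarrow> glue_class Q c x = glue_class Q c y"
    if "x \<in> Q \<times> UNIV" "y \<in> Q \<times> UNIV" for x y
    using that eq[of "fst x" "fst y" "snd x" "snd y"]
      glue_class_eq_iff[of Q c "fst x" "snd x" "fst y" "snd y"] by auto
  obtain g where g: "continuous_map (glued_space Q c) Y g"
    "g ` topspace (glued_space Q c) = f ` topspace (cells Q)"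
    "\<And>x. x \<in> topspace (cells Q) \<Longrightarrow> g (glue_class Q c x) = f x"
    by (rule quotient_map_lift_exists[OF quotient_map_glue_class[of Q c] f(1)]) (use ff in auto)
  have "inj_on g (topspace (glued_space Q c))"
  proof (rule inj_onI)
    fix A B assume "A \<in> topspace (glued_space Q c)" "B \<in> topspace (glued_space Q c)" "g A = g B"
    moreover then obtain x y where "A = glue_class Q c x" "x \<in> Q \<times> UNIV"
        "B = glue_class Q c y" "y \<in> Q \<times> UNIV"
      by (auto simp: topspace_glued_space)
    ultimately show "A = B"
      using g(3)[of x] g(3)[of y] ff[of x y] by simp
  qed
  then have "homeomorphic_map (glued_space Q c) Y g"
    using continuous_imp_homeomorphic_map[OF g(1) compact_glued_space(2)[OF Q] H] g(2) f(2) by simp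
  then show ?thesis
    using homeomorphic_map_imp_homeomorphic_space by blast
qed


subsection \<open>Sectors and facets\<close>

lemma corner_homeoD:
  assumes "corner_homeo X \<F> Y \<G> f"
  shows "continuous_on X f" "f ` X = Y" "inj_on f X" "\<And>F. F \<in> \<F> \<Longrightarrow> f ` F \<in> \<G>"
    "\<And>G. G \<in> \<G> \<Longrightarrow> \<exists>F \<in> \<F>. G = f ` F"
  using assms homeomorphic_imp_continuous_map[of "top_of_set X" "top_of_set Y" f]
    homeomorphic_imp_surjective_map[of "top_of_set X" "top_of_set Y" f]
    homeomorphic_imp_injective_map[of "top_of_set X" "top_of_set Y" f]
  by (auto simp: corner_homeo_def)

lemma corner_homeo_compact:
  assumes "corner_homeo X \<F> Y \<G> f" "compact Y"
  shows "compact X"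
proof -
  have "top_of_set X homeomorphic_space top_of_set Y"
    using assms(1) homeomorphic_map_imp_homeomorphic_space by (auto simp: corner_homeo_def)
  then have "compact_space (top_of_set X) \<longleftrightarrow> compact_space (top_of_set Y)"
    by (rule homeomorphic_compact_space)
  then show ?thesis
    using assms(2) by (simp add: compact_space_subtopology compact_space_def compactin_subtopology)
qed

lemma facet_neq:
  assumes "F \<in> facets P"
  shows "F \<noteq> P"
  using assms by (auto simp: facets_def facet_of_def)

text \<open>\<open>R\<close> stands for either of the two pieces; \<open>swap\<close> turns each
  fact about it into one about the other piece.\<close>

locale cut_polytope =
  fixes S :: "'b::euclidean_space set" and P R R' :: "(real ^ 'n) set" and i :: "'b \<Rightarrow> real ^ 'n"
  assumes P: "simple_polytope CARD('n) P" and S: "simple_polytope (CARD('n) - 1) S"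
    and sector: "sector S P i R R'"
begin

lemma swap: "cut_polytope S P R' R i"
  using P S sector by (auto simp: cut_polytope_def sector_def Un_commute Int_commute)

lemmas P_props = simple_polytopeD[OF P] and S_props = simple_polytopeD[OF S]

lemma aff_dims: "aff_dim P = int CARD('n)" "aff_dim S = int CARD('n) - 1"
  using P S by (auto simp: simple_polytope_def of_nat_diff Suc_leI)

lemma pieces: "R \<union> R' = P" "R \<inter> R' = i ` S"
  using sector by (auto simp: sector_def)

lemma i_props: "continuous_on S i" "inj_on i S" "i ` S \<subseteq> R" "i ` S \<subseteq> R'"
proof -
  have e: "homeomorphic_map (top_of_set S) (subtopology (top_of_set P) (i ` S)) i"
    using sector by (simp add: sector_def embedding_map_def)
  have "continuous_map (top_of_set S) (top_of_set P) i"
    using homeomorphic_imp_continuous_map[OF e] by (rule continuous_map_into_fulltopology)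
  then show "continuous_on S i"
    using continuous_map_iff_continuous continuous_map_into_fulltopology by blast
  show "inj_on i S"
    using homeomorphic_imp_injective_map[OF e] by simp
  show "i ` S \<subseteq> R" "i ` S \<subseteq> R'"
    using pieces by auto
qed

lemma piece_model:
  obtains Q :: "(real ^ 'n) set" and h
  where "simple_polytope CARD('n) Q" "corner_homeo R (piece_facets P (i ` S) R) Q (facets Q) h"
proof -
  have "\<forall>X \<in> {R, R'}. \<exists>(Q :: (real ^ 'n) set) h.
      simple_polytope CARD('n) Q \<and> corner_homeo X (piece_facets P (i ` S) X) Q (facets Q) h"
    using sector unfolding sector_def by (elim conjE)
  then show ?thesis
    using that by (meson insertI1)
qed

lemma compact_piece: "compact R"
proof -
  obtain Q :: "(real ^ 'n) set" and h where "simple_polytope CARD('n) Q"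
    "corner_homeo R (piece_facets P (i ` S) R) Q (facets Q) h"
    using piece_model .
  then show ?thesis
    using corner_homeo_compact simple_polytopeD(2) by blast
qed

lemma sector_face:
  assumes "F face_of S" "F \<noteq> {}"
  shows "\<exists>!H. H face_of P \<and> aff_dim H = aff_dim F + 1 \<and> i ` F \<subseteq> H"
proof -
  have "\<forall>F. F face_of S \<and> F \<noteq> {} \<longrightarrow>
      (\<exists>!H. H face_of P \<and> aff_dim H = aff_dim F + 1 \<and> i ` F \<subseteq> H)"
    using sector unfolding sector_def by (elim conjE)
  then show ?thesis
    using assms by simp
qed

lemma facet_faces:
  assumes "f \<in> facets S"
  shows "f face_of S" "f \<noteq> {}" "aff_dim f + 1 = int CARD('n) - 1"
  using assms aff_dims by (auto simp: facets_def facet_of_def)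

lemma induced_facet:
  assumes f: "f \<in> facets S"
  shows "induced_facet P i f \<in> facets P" "i ` f \<subseteq> induced_facet P i f"
proof -
  note ff = facet_faces[OF f]
  have H: "induced_facet P i f face_of P \<and> aff_dim (induced_facet P i f) = aff_dim f + 1 \<and>
      i ` f \<subseteq> induced_facet P i f"
    unfolding induced_facet_def using sector_face[OF ff(1,2)] by (rule theI')
  then show "i ` f \<subseteq> induced_facet P i f"
    by blast
  then have "induced_facet P i f \<noteq> {}"
    using ff(2) by auto
  then show "induced_facet P i f \<in> facets P"
    using H ff(3) aff_dims by (auto simp: facets_def facet_of_def)
qed

lemma induced_facet_unique:
  assumes f: "f \<in> facets S" and F: "F \<in> facets P" "i ` f \<subseteq> F"
  shows "F = induced_facet P i f"
proof -
  note ff = facet_faces[OF f]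
  have "F face_of P \<and> aff_dim F = aff_dim f + 1 \<and> i ` f \<subseteq> F"
    using F ff(3) aff_dims by (auto simp: facets_def facet_of_def)
  then show ?thesis
    unfolding induced_facet_def using the1_equality[OF sector_face[OF ff(1,2)]] by simp
qed

text \<open>In the model of the piece the sector becomes a facet, hence a proper subset. This
  excludes degenerate cuts.\<close>

lemma piece_not_sector: "R \<noteq> i ` S"
proof
  assume R: "R = i ` S"
  obtain Q :: "(real ^ 'n) set" and h where Q: "simple_polytope CARD('n) Q"
    and h: "corner_homeo R (piece_facets P (i ` S) R) Q (facets Q) h"
    using piece_model .
  have "h ` R \<in> facets Q"
    using corner_homeoD(4)[OF h, of R] by (simp add: R piece_facets_def)
  then show False
    using corner_homeoD(2)[OF h] facet_neq by blast
qed

text \<open>The interior of P is connected, so a sector inside a facet would not cut off anything.\<close>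

lemma sector_not_in_facet:
  assumes F: "F \<in> facets P"
  shows "\<not> i ` S \<subseteq> F"
proof
  assume sub: "i ` S \<subseteq> F"
  interpret sw: cut_polytope S P R' R i
    by (rule swap)
  have hull: "affine hull P = UNIV"
    using aff_dims aff_dim_eq_full[of P] by simp
  then have ri: "rel_interior P = interior P"
    by (rule rel_interior_interior)
  have "F \<inter> rel_interior P = {}"
    using F facet_neq[OF F] facet_of_imp_face_of
    by (intro face_of_disjoint_rel_interior) (simp_all add: facets_def)
  then have disj: "R \<inter> R' \<inter> interior P = {}"
    using sub pieces ri by auto
  have cl: "closure (interior P) = P"
    using convex_closure_rel_interior[OF P_props(3)] ri P_props(5) by simp
  have "closed R" "closed R'"
    using compact_piece sw.compact_piece compact_imp_closed by auto
  moreover have "connected (interior P)"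
    using P_props(3) by (simp add: convex_connected convex_interior)
  moreover have "interior P \<subseteq> R \<union> R'"
    using pieces interior_subset by auto
  ultimately have "R \<inter> interior P = {} \<or> R' \<inter> interior P = {}"
    using disj unfolding connected_closed by blast
  then have "interior P \<subseteq> R \<or> interior P \<subseteq> R'"
    using pieces interior_subset[of P] by blast
  then have "P \<subseteq> R \<or> P \<subseteq> R'"
    using cl \<open>closed R\<close> \<open>closed R'\<close> closure_minimal by metis
  then have "R' = i ` S \<or> R = i ` S"
    using pieces by blast
  then show False
    using piece_not_sector sw.piece_not_sector by blast
qed

lemma facet_piece_neq:
  assumes "F \<in> facets P"
  shows "F \<inter> R \<noteq> i ` S"
  using sector_not_in_facet[OF assms] by blast

end

text \<open>Half-space coordinates are available on the convex model \<open>Q\<close>, not on the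
  possibly curved piece, so facts about the piece are proved on \<open>Q\<close> and pulled back
  along \<open>h\<close>.\<close>

locale cut_model = cut_polytope S P R R' i
  for S :: "'b::euclidean_space set" and P R R' :: "(real ^ 'n) set" and i +
  fixes Q :: "(real ^ 'n) set" and h n b
  assumes h: "corner_homeo R (piece_facets P (i ` S) R) Q (facets Q) h"
    and body: "simple_body Q n b"
begin

interpretation simple_body Q n b
  by (rule body)

lemmas h_props = corner_homeoD[OF h]

definition "T = h ` i ` S"

lemma T: "T \<in> facets Q"
  using h_props(4)[of "i ` S"] by (simp add: T_def piece_facets_def)

text \<open>The middle claim is what makes collars of \<open>T\<close> applicable, since these
  respect the facets different from \<open>T\<close>. It rests on
  \<open>sector_not_in_facet\<close>.\<close>

lemma model_facet:
  assumes "F \<in> facets P" "p \<in> F" "p \<in> R"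
  shows "h ` (F \<inter> R) \<in> facets Q" "h ` (F \<inter> R) \<noteq> T" "h p \<in> h ` (F \<inter> R)"
proof -
  show "h ` (F \<inter> R) \<in> facets Q"
    using assms h_props(4)[of "F \<inter> R"] by (auto simp: piece_facets_def)
  show "h p \<in> h ` (F \<inter> R)"
    using assms by simp
  have "F \<inter> R \<noteq> i ` S"
    using facet_piece_neq[OF assms(1)] .
  then show "h ` (F \<inter> R) \<noteq> T"
    unfolding T_def using inj_on_image_eq_iff[OF h_props(3), of "F \<inter> R" "i ` S"] i_props(3) by auto
qed

lemma mem_model_facet: "p \<in> R \<Longrightarrow> h p \<in> h ` (F \<inter> R) \<longleftrightarrow> p \<in> F"
  using inj_on_image_mem_iff[OF h_props(3), of p "F \<inter> R"] by auto

lemma hi_homeo: "continuous_on S (h \<circ> i)" "inj_on (h \<circ> i) S" "(h \<circ> i) ` S = T"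
proof -
  show "continuous_on S (h \<circ> i)"
    using i_props h_props(1) by (intro continuous_on_compose) (auto intro: continuous_on_subset)
  show "inj_on (h \<circ> i) S"
    using i_props h_props(3) by (intro comp_inj_on) (auto intro: inj_on_subset)
  show "(h \<circ> i) ` S = T"
    by (simp add: T_def image_comp)
qed

text \<open>By invariance of domain \<open>h \<circ> i\<close> maps the relative interior of
  \<open>S\<close> into that of \<open>T\<close>, both having the same dimension. A relative
  interior point of \<open>T\<close> on \<open>G\<close> would force \<open>T\<close> into
  \<open>G\<close>, and facets have equal dimension, so \<open>G\<close> would be
  \<open>T\<close>.\<close>

lemma sector_boundary:
  assumes s: "s \<in> S" and G: "G \<in> facets Q" "G \<noteq> T" "h (i s) \<in> G"
  obtains f where "f \<in> facets S" "s \<in> f"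
proof -
  have aT: "aff_dim T = aff_dim S" "T \<noteq> {}" "T face_of Q" "convex T"
    using T aff_dims simple Q_props by (auto simp: facets_def facet_of_def simple_polytope_def
        face_of_imp_convex)
  have "s \<notin> rel_interior S"
  proof
    assume s: "s \<in> rel_interior S"
    have "openin (top_of_set (affine hull T)) ((h \<circ> i) ` rel_interior S)"
    proof (rule invariance_of_domain_affine_sets[where U = "affine hull S"])
      show "continuous_on (rel_interior S) (h \<circ> i)"
        using hi_homeo(1) rel_interior_subset continuous_on_subset by blast
      show "(h \<circ> i) \<in> rel_interior S \<rightarrow> affine hull T"
        using hi_homeo(3) rel_interior_subset[of S] hull_subset[of T affine] by fastforce
      show "inj_on (h \<circ> i) (rel_interior S)"
        using hi_homeo(2) rel_interior_subset inj_on_subset by blast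
    qed (use aT in \<open>auto simp: openin_rel_interior\<close>)
    then have "(h \<circ> i) ` rel_interior S \<subseteq> rel_interior T"
      using hi_homeo(3) rel_interior_subset[of S] by (intro rel_interior_maximal) blast+
    then have "h (i s) \<in> rel_interior T"
      using s by auto
    moreover have "G \<inter> T face_of T"
      using G(1) aT(3) T face_of_subset[of "G \<inter> T" Q T] face_of_Int[of G Q T] Q_props(7)
      by (auto simp: facets_def facet_of_imp_face_of)
    ultimately have "G \<inter> T = T"
      using G(3) face_of_disjoint_rel_interior[of "G \<inter> T" T] rel_interior_subset[of T] by blast
    then have "T \<subseteq> G"
      by blast
    moreover have "G face_of Q" "aff_dim G = aff_dim T"
      using G T by (auto simp: facets_def facet_of_def)
    ultimately have "T = G"
      using face_of_subset[OF aT(3), of G] face_of_aff_dim_lt[of G T] face_of_imp_convex face_of_imp_subset[of G Q]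
      by (metis less_irrefl)
    then show False
      using G(2) by simp
  qed
  then have "s \<in> \<Union>{F. F facet_of S}"
    using rel_boundary_of_polyhedron[OF S_props(4)] s by blast
  then show ?thesis
    using that by (auto simp: facets_def)
qed

text \<open>
  A point of T and a second facet G of Q is a limit of points lying on no further facet; these
  come from facets of S, of which there are finitely many, all closed.
\<close>

lemma sector_facet_ex:
  assumes s: "s \<in> S" and F: "F \<in> facets P" "i s \<in> F"
  shows "\<exists>f \<in> facets S. s \<in> f \<and> F = induced_facet P i f"
proof -
  define G where "G = h ` (F \<inter> R)"
  have G: "G \<in> facets Q" "G \<noteq> T" "h (i s) \<in> G"
    using model_facet[of F "i s"] F s i_props(3) by (auto simp: G_def)
  have yT: "h (i s) \<in> T"
    using s by (auto simp: T_def)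
  \<comment> \<open>\<open>U\<close> is closed, so if s were outside it, generic points of
    \<open>T\<close> and \<open>G\<close> close to \<open>h (i s)\<close> would avoid its image as
    well; the contradiction is reached at such a point.\<close>
  define U where "U = \<Union>{f \<in> facets S. i ` f \<subseteq> F}"
  have US: "U \<subseteq> S" "closed U"
    using S_props(6,7,8) by (auto simp: U_def intro!: closed_Union)
  then have "compact U"
    using S_props(2) by (metis closed_Int_compact inf.absorb1)
  then have "compact ((h \<circ> i) ` U)"
    using hi_homeo(1) US(1) by (intro compact_continuous_image) (auto intro: continuous_on_subset)
  then have op: "open (- (h \<circ> i) ` U)"
    by (simp add: compact_imp_closed open_Compl)
  have "s \<in> U"
  proof (rule ccontr)
    assume "s \<notin> U"
    then have y: "h (i s) \<in> - (h \<circ> i) ` U"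
      using inj_on_image_mem_iff[OF hi_homeo(2) s US(1)] by simp
    obtain d where d: "\<forall>\<^sub>F e in at_right (0::real). h (i s) + e *\<^sub>R d \<in> T \<and> h (i s) + e *\<^sub>R d \<in> G \<and>
        (\<forall>H \<in> facets Q. h (i s) + e *\<^sub>R d \<in> H \<longrightarrow> H = T \<or> H = G)"
      using ridge_generic_direction[OF T yT G(1,3)] .
    have "((\<lambda>e. h (i s) + e *\<^sub>R d) \<longlongrightarrow> h (i s) + 0 *\<^sub>R d) (at_right (0::real))"
      by (intro tendsto_intros)
    then have "\<forall>\<^sub>F e in at_right (0::real). h (i s) + e *\<^sub>R d \<in> - (h \<circ> i) ` U"
      using op y by (intro topological_tendstoD) auto
    with d have "\<forall>\<^sub>F e in at_right (0::real). h (i s) + e *\<^sub>R d \<in> T \<and> h (i s) + e *\<^sub>R d \<in> G \<and>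
        (\<forall>H \<in> facets Q. h (i s) + e *\<^sub>R d \<in> H \<longrightarrow> H = T \<or> H = G) \<and>
        h (i s) + e *\<^sub>R d \<in> - (h \<circ> i) ` U"
      by eventually_elim blast
    then obtain y where y: "y \<in> T" "y \<in> G" "\<forall>H \<in> facets Q. y \<in> H \<longrightarrow> H = T \<or> H = G"
        "y \<notin> (h \<circ> i) ` U"
      using eventually_happens' trivial_limit_at_right_real by (metis (mono_tags, lifting) ComplD)
    obtain s' where s': "s' \<in> S" "y = h (i s')"
      using y(1) by (auto simp: T_def)
    then have "h (i s') \<in> G"
      using y(2) by simp
    then obtain f where f: "f \<in> facets S" "s' \<in> f"
      using sector_boundary[OF s'(1) G(1,2)] by blast
    define F' where "F' = induced_facet P i f"
    have F': "F' \<in> facets P" "i ` f \<subseteq> F'"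
      using induced_facet[OF f(1)] by (auto simp: F'_def)
    have is': "i s' \<in> F'" "i s' \<in> R"
      using F' f s' i_props(3) by auto
    \<comment> \<open>Genericity is used here: y lies on no facets but \<open>T\<close> and
      \<open>G\<close>, and the trace of \<open>F'\<close> is not sent to \<open>T\<close>.\<close>
    have "h ` (F' \<inter> R) = G"
      using model_facet[OF F'(1) is'] bspec[OF y(3), of "h ` (F' \<inter> R)"] s'(2) by simp
    then have "F' \<inter> R = F \<inter> R"
      unfolding G_def using inj_on_image_eq_iff[OF h_props(3), of "F' \<inter> R" "F \<inter> R"] by simp
    moreover have "i ` f \<subseteq> R"
      using i_props(3) S_props(7)[OF f(1)] by blast
    ultimately have "i ` f \<subseteq> F"
      using F'(2) by blast
    then have "s' \<in> U"
      using f by (auto simp: U_def)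
    then show False
      using y(4) s'(2) by auto
  qed
  then show ?thesis
    using induced_facet_unique F(1) by (auto simp: U_def)
qed

text \<open>The collar of \<open>T\<close> in the model, pulled back along \<open>h\<close>. Facets
  of \<open>P\<close> that meet \<open>R\<close> become facets of \<open>Q\<close> other than
  \<open>T\<close>, which that collar respects; a facet that misses \<open>R\<close> contains
  neither of the two points compared.\<close>

lemma collar:
  obtains \<kappa> :: "'b \<times> real \<Rightarrow> real ^ 'n"
  where "continuous_on (S \<times> {0..1}) \<kappa>" "inj_on \<kappa> (S \<times> {0..1})" "\<kappa> ` (S \<times> {0..1}) \<subseteq> R"
    "\<forall>s \<in> S. \<kappa> (s, 0) = i s"
    "\<forall>F \<in> facets P. \<forall>s \<in> S. \<forall>t \<in> {0..1}. \<kappa> (s, t) \<in> F \<longleftrightarrow> i s \<in> F"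
    "openin (top_of_set R) (\<kappa> ` (S \<times> {0..<1}))"
proof -
  obtain c :: "(real ^ 'n) \<times> real \<Rightarrow> real ^ 'n"
    where c: "continuous_on (T \<times> {0..1}) c" "inj_on c (T \<times> {0..1})" "c ` (T \<times> {0..1}) \<subseteq> Q"
      "\<And>x. x \<in> T \<Longrightarrow> c (x, 0) = x"
      "\<And>G x t. G \<in> facets Q \<Longrightarrow> G \<noteq> T \<Longrightarrow> x \<in> T \<Longrightarrow> t \<in> {0..1} \<Longrightarrow> c (x, t) \<in> G \<longleftrightarrow> x \<in> G"
      "openin (top_of_set Q) (c ` (T \<times> {0..<1}))"
    using facet_collar[OF T] by (metis (no_types, lifting))
  obtain g where hg: "homeomorphism R Q h g"
    using homeomorphism_compact[OF compact_piece h_props(1,2,3)] by blast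
  have g: "continuous_on Q g" "\<And>x. x \<in> Q \<Longrightarrow> h (g x) = x" "\<And>x. x \<in> Q \<Longrightarrow> g x \<in> R"
      "\<And>p. p \<in> R \<Longrightarrow> g (h p) = p"
    using homeomorphism_cont2[OF hg] homeomorphism_apply2[OF hg] homeomorphism_image2[OF hg]
      homeomorphism_apply1[OF hg] by auto
  define \<kappa> where "\<kappa> = (\<lambda>(s, t). g (c (h (i s), t)))"
  have hiT: "h (i s) \<in> T" if "s \<in> S" for s
    using that by (simp add: T_def)
  have cQ: "c (h (i s), t) \<in> Q" if "s \<in> S" "t \<in> {0..1}" for s t
    using c(3) hiT[OF that(1)] that(2) by (meson SigmaI image_eqI subsetD)
  have h\<kappa>: "h (\<kappa> (s, t)) = c (h (i s), t)" "\<kappa> (s, t) \<in> R" if "s \<in> S" "t \<in> {0..1}" for s t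
    using g(2,3)[OF cQ[OF that]] by (simp_all add: \<kappa>_def)
  have "continuous_on (S \<times> {0..1::real}) (\<lambda>x. (h \<circ> i) (fst x))"
    using hi_homeo(1) by (rule continuous_on_compose2) (auto intro: continuous_on_fst)
  then have "continuous_on (S \<times> {0..1::real}) (\<lambda>x. h (i (fst x)))"
    by simp
  then have "continuous_on (S \<times> {0..1}) (\<lambda>x. c (h (i (fst x)), snd x))"
    using hiT by (intro continuous_on_compose2[OF c(1)] continuous_intros) auto
  then have cont: "continuous_on (S \<times> {0..1}) \<kappa>"
    unfolding \<kappa>_def case_prod_unfold using cQ
    by (intro continuous_on_compose2[OF g(1)]) auto
  have inj: "inj_on \<kappa> (S \<times> {0..1})"
  proof (rule inj_onI)
    fix x y assume xy: "x \<in> S \<times> {0..1}" "y \<in> S \<times> {0..1}" "\<kappa> x = \<kappa> y"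
    obtain s t s' t' where st: "x = (s, t)" "y = (s', t')"
      by (cases x, cases y)
    have "c (h (i s), t) = c (h (i s'), t')"
      using xy h\<kappa>(1)[of s t] h\<kappa>(1)[of s' t'] by (simp add: st)
    then have "(h (i s), t) = (h (i s'), t')"
      using xy hiT by (intro inj_onD[OF c(2)]) (auto simp: st)
    then show "x = y"
      using xy inj_onD[OF hi_homeo(2), of s s'] by (simp add: st)
  qed
  have "\<kappa> ` (S \<times> {0..<1}) = R \<inter> h -` (c ` (T \<times> {0..<1}))"
  proof (intro equalityI subsetI)
    fix p assume "p \<in> \<kappa> ` (S \<times> {0..<1})"
    then show "p \<in> R \<inter> h -` (c ` (T \<times> {0..<1}))"
      using h\<kappa> hiT by force
  next
    fix p assume p: "p \<in> R \<inter> h -` (c ` (T \<times> {0..<1}))"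
    then obtain s t where st: "s \<in> S" "t \<in> {0..<1}" "h p = c (h (i s), t)"
      by (auto simp: T_def)
    then have "h p = h (\<kappa> (s, t))" "\<kappa> (s, t) \<in> R"
      using h\<kappa>[of s t] by auto
    then have "p = \<kappa> (s, t)"
      using p h_props(3) by (auto dest: inj_onD)
    then show "p \<in> \<kappa> ` (S \<times> {0..<1})"
      using st by blast
  qed
  then have ope: "openin (top_of_set R) (\<kappa> ` (S \<times> {0..<1}))"
    using continuous_on_open[of R h] h_props(1,2) c(6) by simp
  show ?thesis
  proof (rule that[OF cont inj])
    show "\<kappa> ` (S \<times> {0..1}) \<subseteq> R"
      using h\<kappa>(2) by auto
    show "\<forall>s \<in> S. \<kappa> (s, 0) = i s"
    proof
      fix s assume s: "s \<in> S"
      then have "\<kappa> (s, 0) = g (h (i s))"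
        using c(4)[OF hiT] by (simp add: \<kappa>_def)
      then show "\<kappa> (s, 0) = i s"
        using g(4) i_props(3) s by auto
    qed
    show "\<forall>F \<in> facets P. \<forall>s \<in> S. \<forall>t \<in> {0..1}. \<kappa> (s, t) \<in> F \<longleftrightarrow> i s \<in> F"
    proof (intro ballI)
      fix F s t assume F: "F \<in> facets P" and s: "s \<in> S" and t: "t \<in> {0..1::real}"
      have R: "\<kappa> (s, t) \<in> R" "i s \<in> R"
        using h\<kappa>(2)[OF s t] i_props(3) s by auto
      have mem: "h (\<kappa> (s, t)) \<in> h ` (F \<inter> R) \<longleftrightarrow> \<kappa> (s, t) \<in> F" "h (i s) \<in> h ` (F \<inter> R) \<longleftrightarrow> i s \<in> F"
        by (rule mem_model_facet, rule R)+
      show "\<kappa> (s, t) \<in> F \<longleftrightarrow> i s \<in> F"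
      proof (cases "F \<inter> R = {}")
        case True
        then show ?thesis using R by blast
      next
        case False
        then obtain p where "p \<in> F" "p \<in> R" by blast
        from c(5)[OF model_facet(1,2)[OF F this] hiT[OF s] t] show ?thesis
          by (simp only: flip: mem h\<kappa>(1)[OF s t])
      qed
    qed
  qed (rule ope)
qed

end

section \<open>Collars and local spans at the sector, with the model eliminated\<close>

context cut_polytope
begin

lemma model_exists:
  obtains Q :: "(real ^ 'n) set" and h n b where "cut_model S P R R' i Q h n b"
proof -
  obtain Q :: "(real ^ 'n) set" and h where Q: "simple_polytope CARD('n) Q"
    and h: "corner_homeo R (piece_facets P (i ` S) R) Q (facets Q) h"
    using piece_model .
  have "polytope Q" "aff_dim Q = int DIM(real ^ 'n)"
    using Q by (auto simp: simple_polytope_def)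
  then obtain n b where nb: "\<forall>G \<in> facets Q. G = {x \<in> Q. n G \<bullet> x = b G}"
    "Q = {x. \<forall>G \<in> facets Q. n G \<bullet> x \<le> (b G :: real)}"
    by (rule polytope_facet_halfspaces)
  then have "simple_body Q n b"
    using Q by (simp add: simple_body_def)
  then have "cut_model S P R R' i Q h n b"
    using h cut_polytope_axioms by (simp add: cut_model_def cut_model_axioms_def)
  then show ?thesis
    using that by blast
qed

lemma sector_collar:
  obtains \<kappa> :: "'b \<times> real \<Rightarrow> real ^ 'n"
  where "continuous_on (S \<times> {0..1}) \<kappa>" "inj_on \<kappa> (S \<times> {0..1})" "\<kappa> ` (S \<times> {0..1}) \<subseteq> R"
    "\<forall>s \<in> S. \<kappa> (s, 0) = i s"
    "\<forall>F \<in> facets P. \<forall>s \<in> S. \<forall>t \<in> {0..1}. \<kappa> (s, t) \<in> F \<longleftrightarrow> i s \<in> F"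
    "openin (top_of_set R) (\<kappa> ` (S \<times> {0..<1}))"
proof -
  obtain Q h n b where "cut_model S P R R' i Q h n b"
    using model_exists .
  then interpret cut_model S P R R' i Q h n b .
  show ?thesis
    by (rule collar) (rule that)
qed

lemma facets_at_sector:
  assumes s: "s \<in> S"
  shows "{F \<in> facets P. i s \<in> F} = induced_facet P i ` {f \<in> facets S. s \<in> f}"
proof -
  obtain Q h n b where "cut_model S P R R' i Q h n b"
    using model_exists .
  then have "\<exists>f \<in> facets S. s \<in> f \<and> F = induced_facet P i f" if "F \<in> facets P" "i s \<in> F" for F
    using cut_model.sector_facet_ex s that by metis
  then show ?thesis
    using induced_facet by blast
qed

text \<open>The identifications over s in the sector manifold are those over \<open>i s\<close> in
  the glued polytope, so the sector manifold sits injectively inside it.\<close>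

lemma local_span_sector:
  assumes "s \<in> S"
  shows "local_span S (derived_coloring P c i) s = local_span P c (i s)"
  using facets_at_sector[OF assms] by (simp add: local_span_def derived_coloring_def image_comp)

end


subsection \<open>Cutting and regluing\<close>

lemma local_span_image:
  fixes A :: "bit ^ 'n ^ 'n"
  assumes "c' ` {F \<in> facets Q'. p' \<in> F} = (\<lambda>F. A *v c F) ` {F \<in> facets Q. p \<in> F}"
  shows "local_span Q' c' p' = (*v) A ` local_span Q c p"
proof -
  have "local_span Q' c' p' = vec.span ((*v) A ` (c ` {F \<in> facets Q. p \<in> F}))"
    using assms by (simp add: local_span_def image_image)
  also have "\<dots> = (*v) A ` local_span Q c p"
    unfolding local_span_def by (rule vec.linear_span_image[OF matrix_vector_mul_linear_gen])
  finally show ?thesis .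
qed

text \<open>No facet of \<open>P\<close> or \<open>P'\<close> restricts to the sector, so
  \<open>g\<close> matches the traces of their facets on the two pieces with each other. The
  recoloring \<open>\<phi>\<close> is left open in order to serve both pieces: the identity on the
  first, the inverse of the matrix on the second.\<close>

lemma piece_colors:
  assumes "cut_polytope S P R R2 i" "cut_polytope S P' R' R2' j"
    and g: "corner_homeo R (piece_facets P (i ` S) R) R' (piece_facets P' (j ` S) R') g"
    and gS: "g ` i ` S = j ` S"
    and col: "\<And>F F1. F \<in> facets P' \<Longrightarrow> F \<inter> R' \<noteq> {} \<Longrightarrow> F1 \<in> facets P \<Longrightarrow> F1 \<inter> R \<noteq> {} \<Longrightarrow>
      g ` (F1 \<inter> R) \<subseteq> F \<Longrightarrow> c' F = \<phi> (c F1)"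
    and p: "p \<in> R"
  shows "c' ` {F \<in> facets P'. g p \<in> F} = (\<lambda>F. \<phi> (c F)) ` {F \<in> facets P. p \<in> F}"
proof -
  interpret A: cut_polytope S P R R2 i by fact
  interpret B: cut_polytope S P' R' R2' j by fact
  note gp = corner_homeoD[OF g]
  have gR: "g p \<in> R'"
    using gp(2) p by blast
  have match: "c' F' = \<phi> (c F)" if "F \<in> facets P" "F' \<in> facets P'" "p \<in> F" "g ` (F \<inter> R) = F' \<inter> R'"
    for F F'
    using that p col[of F' F] by fastforce
  have 1: "\<exists>F' \<in> facets P'. g ` (F \<inter> R) = F' \<inter> R'" if F: "F \<in> facets P" "p \<in> F" for F
  proof -
    have "F \<inter> R \<in> piece_facets P (i ` S) R"
      using F p by (auto simp: piece_facets_def)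
    then have "g ` (F \<inter> R) \<in> piece_facets P' (j ` S) R'"
      by (rule gp(4))
    moreover have "g ` (F \<inter> R) \<noteq> j ` S"
      using inj_on_image_eq_iff[OF gp(3), of "F \<inter> R" "i ` S"] A.i_props(3) A.facet_piece_neq[OF F(1)]
      by (simp add: gS)
    ultimately show ?thesis
      by (auto simp: piece_facets_def)
  qed
  have 2: "\<exists>F \<in> facets P. g ` (F \<inter> R) = F' \<inter> R'" if F': "F' \<in> facets P'" "g p \<in> F'" for F'
  proof -
    have "F' \<inter> R' \<in> piece_facets P' (j ` S) R'"
      using F' gR by (auto simp: piece_facets_def)
    then obtain E where E: "E \<in> piece_facets P (i ` S) R" "F' \<inter> R' = g ` E"
      using gp(5) by blast
    moreover have "E \<noteq> i ` S"
      using B.facet_piece_neq[OF F'(1)] E(2) gS by auto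
    ultimately show ?thesis
      by (auto simp: piece_facets_def)
  qed
  show ?thesis
  proof (intro equalityI subsetI)
    fix u assume "u \<in> c' ` {F \<in> facets P'. g p \<in> F}"
    then obtain F' where F': "F' \<in> facets P'" "g p \<in> F'" "u = c' F'"
      by blast
    then obtain F where F: "F \<in> facets P" "g ` (F \<inter> R) = F' \<inter> R'"
      using 2 by blast
    have "g p \<in> g ` (F \<inter> R)"
      using F(2) F'(2) gR by simp
    then have "p \<in> F"
      using inj_on_image_mem_iff[OF gp(3) p, of "F \<inter> R"] by simp
    then show "u \<in> (\<lambda>F. \<phi> (c F)) ` {F \<in> facets P. p \<in> F}"
      using match[OF F(1) F'(1) _ F(2)] F(1) F'(3) by auto
  next
    fix u assume "u \<in> (\<lambda>F. \<phi> (c F)) ` {F \<in> facets P. p \<in> F}"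
    then obtain F where F: "F \<in> facets P" "p \<in> F" "u = \<phi> (c F)"
      by blast
    then obtain F' where F': "F' \<in> facets P'" "g ` (F \<inter> R) = F' \<inter> R'"
      using 1 by blast
    have "g p \<in> F'"
      using F(2) F'(2) p by blast
    then show "u \<in> c' ` {F \<in> facets P'. g p \<in> F}"
      using match[OF F(1) F'(1) F(2) F'(2)] F'(1) F(3) by (metis (mono_tags, lifting) image_eqI mem_Collect_eq)
  qed
qed

text \<open>Since \<open>\<psi>\<close> permutes facets and \<open>\<rho>\<close> recolors
  accordingly, \<open>\<rho>\<close> carries the local span at s into the one at
  \<open>\<psi> s\<close>. Hence the classes in the union all coincide; the two copies of
  \<open>v0\<close> cancel.\<close>

lemma twist_glue_class:
  assumes iso: "iso_pair S c \<psi> \<rho>"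
  shows "twist S c \<psi> \<rho> v0 (glue_class S c (s, v)) = glue_class S c (\<psi> s, \<rho> *v v + v0)"
proof -
  have \<psi>: "corner_homeo S (facets S) S (facets S) \<psi>"
    and col: "\<And>f. f \<in> facets S \<Longrightarrow> c (\<psi> ` f) = \<rho> *v c f"
    using iso by (auto simp: iso_pair_def Aut_def)
  have sub: "\<rho> *v u \<in> local_span S c (\<psi> s)" if "u \<in> local_span S c s" for u
  proof -
    have "\<rho> *v u \<in> vec.span ((*v) \<rho> ` (c ` {f \<in> facets S. s \<in> f}))"
      using that unfolding local_span_def vec.linear_span_image[OF matrix_vector_mul_linear_gen]
      by (rule imageI)
    moreover have "(*v) \<rho> ` (c ` {f \<in> facets S. s \<in> f}) \<subseteq> c ` {f \<in> facets S. \<psi> s \<in> f}"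
    proof (clarsimp simp: image_iff)
      fix f assume f: "f \<in> facets S" "s \<in> f"
      then have "\<psi> ` f \<in> facets S" "\<psi> s \<in> \<psi> ` f"
        using corner_homeoD(4)[OF \<psi>] by auto
      then show "\<exists>x. x \<in> facets S \<and> \<psi> s \<in> x \<and> \<rho> *v c f = c x"
        using col[OF f(1)] by metis
    qed
    ultimately show ?thesis
      unfolding local_span_def using vec.span_mono by blast
  qed
  have mem: "(s', w) \<in> glue_class S c (s, v) \<longleftrightarrow> s = s' \<and> v + w \<in> local_span S c s" for s' w
    unfolding glue_class_def mem_Collect_eq equivclp_glue_step_iff by (rule refl)
  have "glue_class S c (\<psi> s', \<rho> *v w + v0) = glue_class S c (\<psi> s, \<rho> *v v + v0)"
    if "(s', w) \<in> glue_class S c (s, v)" for s' w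
  proof -
    have "s = s' \<and> v + w \<in> local_span S c s"
      using that unfolding mem .
    then have "s = s'" "v + w \<in> local_span S c s"
      by (rule conjunct1, rule conjunct2)
    moreover have "\<rho> *v w + v0 + (\<rho> *v v + v0) = \<rho> *v (v + w) + (v0 + v0)"
      by (simp add: matrix_vector_right_distrib add_ac)
    ultimately show ?thesis
      using sub[of "v + w"] by (simp add: glue_class_eq_iff vec_bit_add_self)
  qed
  moreover have "(s, v) \<in> glue_class S c (s, v)"
    by (simp add: mem vec_bit_add_self local_span_def vec.span_zero)
  ultimately show ?thesis
    unfolding twist_def by blast
qed

text \<open>The topological core, in which facets and colors survive only through local spans and
  convexity plays no part. \<open>\<sigma>\<close> stands for the inverse of \<open>\<rho>\<close>;
  the collar lies in the second piece, and the homotopy runs from the twist at time 0 to the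
  identity at time 1.\<close>

locale regluing =
  fixes P P1 P2 :: "'a::euclidean_space set" and P' P1' P2' :: "'c::euclidean_space set"
    and S :: "'b::euclidean_space set" and i :: "'b \<Rightarrow> 'a" and j :: "'b \<Rightarrow> 'c"
    and g1 g2 :: "'a \<Rightarrow> 'c" and \<psi> :: "'b \<Rightarrow> 'b"
    and c :: "'a set \<Rightarrow> bit ^ 'n" and c' :: "'c set \<Rightarrow> bit ^ 'n" and d :: "'b set \<Rightarrow> bit ^ 'n"
    and \<rho> \<sigma> :: "bit ^ 'n \<Rightarrow> bit ^ 'n" and v0 :: "bit ^ 'n"
    and \<kappa> :: "'b \<times> real \<Rightarrow> 'a"
    and h :: "real \<times> ('b \<times> (bit ^ 'n)) set \<Rightarrow> ('b \<times> (bit ^ 'n)) set"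
  assumes compact: "compact P" "compact P1" "compact P2" "compact S"
    and P: "P1 \<union> P2 = P" "P1 \<inter> P2 = i ` S"
    and P': "P1' \<union> P2' = P'" "P1' \<inter> P2' = j ` S"
    and H: "Hausdorff_space (glued_space P' c')"
    and g1: "continuous_on P1 g1" "g1 ` P1 = P1'" "inj_on g1 P1"
    and g2: "continuous_on P2 g2" "g2 ` P2 = P2'" "inj_on g2 P2"
    and g1j: "\<And>s. s \<in> S \<Longrightarrow> g1 (i s) = j s"
    and g2j: "\<And>s. s \<in> S \<Longrightarrow> g2 (i (\<psi> s)) = j s"
    and \<psi>: "\<psi> ` S = S"
    and span1: "\<And>p. p \<in> P1 \<Longrightarrow> local_span P' c' (g1 p) = local_span P c p"
    and span2: "\<And>p u. p \<in> P2 \<Longrightarrow> \<sigma> u \<in> local_span P' c' (g2 p) \<longleftrightarrow> u \<in> local_span P c p"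
    and \<sigma>: "\<And>u w. \<sigma> (u + w) = \<sigma> u + \<sigma> w" "\<And>v. \<sigma> (\<rho> v) = v"
    and spanS: "\<And>s. s \<in> S \<Longrightarrow> local_span S d s = local_span P c (i s)"
    and \<kappa>: "continuous_on (S \<times> {0..1}) \<kappa>" "inj_on \<kappa> (S \<times> {0..1})" "\<kappa> ` (S \<times> {0..1}) \<subseteq> P2"
      "\<And>s. s \<in> S \<Longrightarrow> \<kappa> (s, 0) = i s"
      "\<And>s t. s \<in> S \<Longrightarrow> t \<in> {0..1} \<Longrightarrow> local_span P c (\<kappa> (s, t)) = local_span P c (i s)"
      "openin (top_of_set P2) (\<kappa> ` (S \<times> {0..<1}))"
    and h: "continuous_map (prod_topology (top_of_set {0..1}) (glued_space S d)) (glued_space S d) h"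
      "\<And>s v. s \<in> S \<Longrightarrow> h (0, glue_class S d (s, v)) = glue_class S d (\<psi> s, \<rho> v + v0)"
      "\<And>x. h (1, x) = x"
      "\<And>t. t \<in> {0..1} \<Longrightarrow>
        bij_betw (\<lambda>x. h (t, x)) (topspace (glued_space S d)) (topspace (glued_space S d))"
begin

section \<open>The second piece and the collar of the sector manifold\<close>

abbreviation "q' \<equiv> glue_class P' c'"
abbreviation "qS \<equiv> glue_class S d"
abbreviation "I \<equiv> {0..1::real}"

definition "K = \<kappa> ` (S \<times> I)"
definition "E x = q' (g2 (fst x), \<sigma> (snd x + v0))"

lemma K_sub: "K \<subseteq> P2"
  using \<kappa>(3) by (simp add: K_def)

lemma iS_K: "i ` S \<subseteq> K"
  using \<kappa>(4) by (force simp: K_def)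

lemma E_eq_iff:
  assumes "p \<in> P2" "p' \<in> P2"
  shows "E (p, v) = E (p', w) \<longleftrightarrow> p = p' \<and> v + w \<in> local_span P c p"
proof -
  have "\<sigma> (v + v0) + \<sigma> (w + v0) = \<sigma> ((v + w) + (v0 + v0))"
    by (simp only: \<sigma>(1) add_ac)
  also have "\<dots> = \<sigma> (v + w)"
    by (simp add: vec_bit_add_self)
  finally have "\<sigma> (v + v0) + \<sigma> (w + v0) = \<sigma> (v + w)" .
  then show ?thesis
    using assms span2[OF assms(1)] inj_on_eq_iff[OF g2(3) assms] by (simp add: E_def glue_class_eq_iff)
qed

lemma E_cont: "continuous_map (cells P2) (glued_space P' c') E"
proof -
  have "continuous_map (top_of_set P2) (glued_space P' c') (\<lambda>p. E (p, v))" for v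
  proof -
    have "continuous_map (top_of_set P2) (cells P') (\<lambda>p. (g2 p, \<sigma> (v + v0)))"
      using g2 P' by (auto simp: continuous_map_paired continuous_map_in_subtopology)
    then show ?thesis
      unfolding E_def fst_conv snd_conv
      using continuous_map_compose[OF _ continuous_map_glue_class] by (auto simp: o_def)
  qed
  then show ?thesis
    by (intro continuous_map_from_prod_discrete) simp
qed

text \<open>The collar in terms of classes, as the isotopy requires. It is well defined because the
  local span is constant along each collar line. It is continuous because the interval is compact
  Hausdorff, so that its product with the quotient map of the sector manifold is again a quotient
  map.\<close>

lemma collar_lift:
  obtains J where
    "continuous_map (prod_topology (top_of_set I) (glued_space S d)) (glued_space P' c') J"
    "\<And>s t v. s \<in> S \<Longrightarrow> t \<in> I \<Longrightarrow> J (t, qS (s, v)) = E (\<kappa> (s, t), v)"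
proof -
  let ?Q = "\<lambda>(t :: real, x). (t, qS x)"
  let ?e = "\<lambda>y. E (\<kappa> (fst (snd y), fst y), snd (snd y))"
  have "continuous_map (prod_topology (top_of_set I) (cells S)) (prod_topology (top_of_set S) (top_of_set I))
      (\<lambda>y. (fst (snd y), fst y))"
    unfolding continuous_map_paired
    using continuous_map_compose[OF continuous_map_snd continuous_map_fst, of "top_of_set I" "top_of_set S"]
      continuous_map_fst by (auto simp: o_def)
  then have pair: "continuous_map (prod_topology (top_of_set I) (cells S)) (top_of_set (S \<times> I))
      (\<lambda>y. (fst (snd y), fst y))"
    by simp
  have "continuous_map (top_of_set (S \<times> I)) (top_of_set P2) \<kappa>"
    using \<kappa>(1,3) by (auto simp: continuous_map_in_subtopology)
  from continuous_map_compose[OF pair this]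
  have "continuous_map (prod_topology (top_of_set I) (cells S)) (top_of_set P2)
      (\<lambda>y. \<kappa> (fst (snd y), fst y))"
    by (simp add: o_def)
  moreover have "continuous_map (prod_topology (top_of_set I) (cells S)) (discrete_topology UNIV)
      (\<lambda>y. snd (snd y))"
    using continuous_map_compose[OF continuous_map_snd continuous_map_snd] by (simp add: o_def)
  ultimately have "continuous_map (prod_topology (top_of_set I) (cells S)) (cells P2)
      (\<lambda>y. (\<kappa> (fst (snd y), fst y), snd (snd y)))"
    by (simp add: continuous_map_paired)
  from continuous_map_compose[OF this E_cont]
  have cont: "continuous_map (prod_topology (top_of_set I) (cells S)) (glued_space P' c') ?e"
    by (simp add: o_def)
  have quot: "quotient_map (prod_topology (top_of_set I) (cells S))
      (prod_topology (top_of_set I) (glued_space S d)) ?Q"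
    by (intro quotient_map_prod_right quotient_map_glue_class)
      (auto simp: Hausdorff_space_subtopology compact_space_subtopology
        intro!: compact_imp_locally_compact_space)
  have wd: "?e x = ?e y" if "x \<in> topspace (prod_topology (top_of_set I) (cells S))"
    "y \<in> topspace (prod_topology (top_of_set I) (cells S))" "?Q x = ?Q y" for x y
  proof -
    obtain t s v t' s' w where xy: "x = (t, s, v)" "y = (t', s', w)"
      by (cases x, cases y) auto
    have st: "t \<in> I" "s \<in> S" and eq: "t = t'" "s = s'" "v + w \<in> local_span S d s"
      using that by (auto simp: xy glue_class_eq_iff)
    have "\<kappa> (s, t) \<in> P2"
      using \<kappa>(3) st by blast
    moreover have "v + w \<in> local_span P c (\<kappa> (s, t))"
      using eq(3) spanS[OF st(2)] \<kappa>(5)[OF st(2,1)] by simp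
    ultimately show ?thesis
      using eq by (simp add: xy E_eq_iff)
  qed
  obtain J where J: "continuous_map (prod_topology (top_of_set I) (glued_space S d)) (glued_space P' c') J"
      "\<And>y. y \<in> topspace (prod_topology (top_of_set I) (cells S)) \<Longrightarrow> J (?Q y) = ?e y"
    by (rule quotient_map_lift_exists[OF quot cont wd]) (assumption | blast)+
  show ?thesis
  proof (rule that[OF J(1)])
    fix s t v assume "s \<in> S" "t \<in> I"
    then show "J (t, qS (s, v)) = E (\<kappa> (s, t), v)"
      using J(2)[of "(t, s, v)"] by simp
  qed
qed

lemma h_class:
  assumes "s \<in> S" "t \<in> I"
  obtains s1 v1 where "s1 \<in> S" "h (t, qS (s, v)) = qS (s1, v1)"
proof -
  have "qS (s, v) \<in> topspace (glued_space S d)"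
    using assms by (auto simp: topspace_glued_space)
  then have "h (t, qS (s, v)) \<in> topspace (glued_space S d)"
    using h(4)[OF assms(2)] bij_betwE by blast
  then show ?thesis
    using that by (auto simp: topspace_glued_space)
qed

definition "param = the_inv_into (S \<times> I) \<kappa>"
definition "A x = q' (g1 (fst x), snd x)"

lemma param: "s \<in> S \<Longrightarrow> t \<in> I \<Longrightarrow> param (\<kappa> (s, t)) = (s, t)"
  unfolding param_def using \<kappa>(2) by (intro the_inv_into_f_f) auto

lemma compact_K: "compact K"
  unfolding K_def using \<kappa>(1) compact(4) by (intro compact_continuous_image compact_Times) auto

lemma param_cont: "continuous_on K param"
  unfolding K_def param_def using \<kappa>(1,2) compact(4) by (simp add: continuous_on_inv_into compact_Times)

lemma A_eq_iff:
  assumes "p \<in> P1" "p' \<in> P1"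
  shows "A (p, v) = A (p', w) \<longleftrightarrow> p = p' \<and> v + w \<in> local_span P c p"
  using assms span1[OF assms(1)] inj_on_eq_iff[OF g1(3) assms] by (simp add: A_def glue_class_eq_iff)

lemma A_cont: "continuous_map (cells P1) (glued_space P' c') A"
proof -
  have "continuous_map (top_of_set P1) (glued_space P' c') (\<lambda>p. A (p, v))" for v
  proof -
    have "continuous_map (top_of_set P1) (cells P') (\<lambda>p. (g1 p, v))"
      using g1 P' by (auto simp: continuous_map_paired continuous_map_in_subtopology)
    then show ?thesis
      unfolding A_def fst_conv snd_conv
      using continuous_map_compose[OF _ continuous_map_glue_class] by (auto simp: o_def)
  qed
  then show ?thesis
    by (intro continuous_map_from_prod_discrete) simp
qed

text \<open>The collar lies in the second piece, so it can meet the first one only in the sector,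
  which is its level 0.\<close>

lemma \<kappa>_P1:
  assumes "s \<in> S" "t \<in> I" "\<kappa> (s, t) \<in> P1"
  shows "t = 0"
proof -
  have "\<kappa> (s, t) \<in> i ` S"
    using assms \<kappa>(3) P(2) by blast
  then obtain s1 where "s1 \<in> S" "\<kappa> (s, t) = \<kappa> (s1, 0)"
    using \<kappa>(4) by auto
  then show ?thesis
    using param[of s t] param[of s1 0] assms by simp
qed

text \<open>The images of the pieces meet only over \<open>j\<close>
  S\<open>, and\<close>g2\<open>takes the points of\<close>i \<open>S\<close> there; injectivity of
  \<open>g2\<close> does the rest.\<close>

lemma E_neq_A:
  assumes "p \<in> P2" "p' \<in> P1" "E (p, v) = A (p', w)"
  shows "p \<in> i ` S"
proof -
  have "g2 p = g1 p'"
    using assms(3) by (simp add: E_def A_def glue_class_eq_iff)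
  then have "g2 p \<in> j ` S"
    using assms P'(2) g1(2) g2(2) by blast
  then obtain s where s: "s \<in> S" "g2 p = g2 (i (\<psi> s))"
    using g2j by auto
  then have "\<psi> s \<in> S"
    using \<psi> by blast
  then show ?thesis
    using inj_onD[OF g2(3) s(2) assms(1)] P(2) by blast
qed

lemma glued_spaces_homeomorphic:
  "glued_space P c homeomorphic_space glued_space P' c'"
proof -
  obtain J where
    J: "continuous_map (prod_topology (top_of_set I) (glued_space S d)) (glued_space P' c') J"
      "\<And>s t v. s \<in> S \<Longrightarrow> t \<in> I \<Longrightarrow> J (t, qS (s, v)) = E (\<kappa> (s, t), v)"
    using collar_lift by metis
  \<comment> \<open>At level t of the collar the stage \<open>h (t, _)\<close> is applied before the
    collar is mapped into the target. This interpolates between \<open>A\<close> on the sector and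
    \<open>E\<close> on the outer edge.\<close>
  define B where "B x = J (snd (param (fst x)), h (snd (param (fst x)), qS (fst (param (fst x)), snd x)))" for x
  define \<Theta> where "\<Theta> x = (if fst x \<in> P1 then A x else if fst x \<in> K then B x else E x)" for x
  have B\<kappa>: "B (\<kappa> (s, t), v) = J (t, h (t, qS (s, v)))" if "s \<in> S" "t \<in> I" for s t v
    using param[OF that] by (simp add: B_def)
  \<comment> \<open>At time 0 the stage is the twist. The shift built into \<open>E\<close> removes
    its \<open>v0\<close>, \<open>\<sigma>\<close> undoes \<open>\<rho>\<close>, and
    \<open>g2\<close> absorbs \<open>\<psi>\<close>.\<close>
  have AB: "A (i s, v) = B (i s, v)" if s: "s \<in> S" for s v
  proof -
    have \<psi>s: "\<psi> s \<in> S"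
      using s \<psi> by blast
    have "B (i s, v) = J (0, h (0, qS (s, v)))"
      using B\<kappa>[of s 0 v] s \<kappa>(4) by simp
    also have "\<dots> = J (0, qS (\<psi> s, \<rho> v + v0))"
      using h(2)[OF s] by simp
    also have "\<dots> = E (i (\<psi> s), \<rho> v + v0)"
      using J(2)[OF \<psi>s, of 0] \<kappa>(4)[OF \<psi>s] by simp
    also have "\<dots> = q' (j s, v)"
      using g2j[OF s] \<sigma>(2) by (simp add: E_def add.assoc vec_bit_add_self)
    also have "\<dots> = A (i s, v)"
      using g1j[OF s] by (simp add: A_def)
    finally show ?thesis ..
  qed
  have BE: "B (\<kappa> (s, 1), v) = E (\<kappa> (s, 1), v)" if "s \<in> S" for s v
    using B\<kappa>[OF that, of 1] J(2)[OF that, of 1] h(3) by simp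
  have \<Theta>A: "\<Theta> (p, v) = A (p, v)" if "p \<in> P1" for p v
    using that by (simp add: \<Theta>_def)
  have \<Theta>B: "\<Theta> (\<kappa> (s, t), v) = J (t, h (t, qS (s, v)))" if "s \<in> S" "t \<in> I" for s t v
  proof (cases "\<kappa> (s, t) \<in> P1")
    case True
    then have "t = 0"
      using \<kappa>_P1 that by blast
    then show ?thesis
      using True AB[OF that(1)] B\<kappa>[OF that] \<kappa>(4)[OF that(1)] by (simp add: \<Theta>_def)
  next
    case False
    moreover have "\<kappa> (s, t) \<in> K"
      using that by (auto simp: K_def)
    ultimately show ?thesis
      using B\<kappa>[OF that] by (simp add: \<Theta>_def)
  qed
  have \<Theta>E: "\<Theta> (p, v) = E (p, v)" if "p \<in> P2" "p \<notin> K" for p v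
  proof -
    have "p \<notin> P1"
      using that iS_K P(2) by blast
    then show ?thesis
      using that by (simp add: \<Theta>_def)
  qed
  have B_cont: "continuous_map (top_of_set K) (glued_space P' c') (\<lambda>p. B (p, v))" for v
  proof -
    have "param ` K \<subseteq> S \<times> I"
      using param by (auto simp: K_def)
    then have "continuous_map (top_of_set K) (top_of_set S) (\<lambda>p. fst (param p))"
      "continuous_map (top_of_set K) (top_of_set I) (\<lambda>p. snd (param p))"
      using param_cont by (auto simp: continuous_map_in_subtopology intro!: continuous_intros)
    note fs = this
    have "continuous_map (top_of_set K) (cells S) (\<lambda>p. (fst (param p), v))"
      using fs by (simp add: continuous_map_paired)
    from continuous_map_compose[OF this continuous_map_glue_class]
    have "continuous_map (top_of_set K) (prod_topology (top_of_set I) (glued_space S d))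
        (\<lambda>p. (snd (param p), qS (fst (param p), v)))"
      using fs by (simp add: continuous_map_paired o_def)
    from continuous_map_compose[OF this h(1)]
    have "continuous_map (top_of_set K) (prod_topology (top_of_set I) (glued_space S d))
        (\<lambda>p. (snd (param p), h (snd (param p), qS (fst (param p), v))))"
      using fs by (simp add: continuous_map_paired o_def)
    from continuous_map_compose[OF this J(1)] show ?thesis
      by (simp add: B_def o_def)
  qed
  have slice: "continuous_map (top_of_set X) Y (\<lambda>p. f (p, v))"
    if "continuous_map (cells X) Y f" for X :: "'a set" and Y f v
  proof -
    have "continuous_map (top_of_set X) (cells X) (\<lambda>p. (p, v))"
      by (simp add: continuous_map_paired)
    from continuous_map_compose[OF this that] show ?thesis
      by (simp add: o_def)
  qed
  \<comment> \<open>Only the half-open collar is removed, so \<open>K1\<close> is closed and keeps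
    the outer edge t = 1, where \<open>B\<close> and \<open>E\<close> agree. \<open>P1\<close>,
    \<open>K\<close> and \<open>K1\<close> then form a closed cover for pasting.\<close>
  define K1 where "K1 = P2 - \<kappa> ` (S \<times> {0..<1})"
  have K1: "closed K1" "K1 \<subseteq> P2"
  proof -
    have "closedin (top_of_set P2) K1"
      unfolding K1_def using \<kappa>(6) by (metis closedin_diff closedin_topspace topspace_euclidean_subtopology)
    then show "closed K1"
      using compact(3) closedin_closed_trans compact_imp_closed by blast
  qed (auto simp: K1_def)
  have \<Theta>K1: "\<Theta> (p, v) = E (p, v)" if "p \<in> K1" for p v
  proof (cases "p \<in> K")
    case True
    then obtain s t where st: "s \<in> S" "t \<in> I" "p = \<kappa> (s, t)"
      by (auto simp: K_def)
    then have "t = 1"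
      using that by (force simp: K1_def)
    then show ?thesis
      using \<Theta>B[OF st(1,2)] BE[OF st(1)] B\<kappa>[OF st(1,2)] st(3) by simp
  next
    case False
    then show ?thesis
      using \<Theta>E that K1(2) by blast
  qed
  have \<Theta>K: "\<Theta> (p, v) = B (p, v)" if p: "p \<in> K" for p v
  proof -
    obtain s t where st: "s \<in> S" "t \<in> I" "p = \<kappa> (s, t)"
      using p by (auto simp: K_def)
    then show ?thesis
      using \<Theta>B B\<kappa> by simp
  qed
  have \<Theta>_cont: "continuous_map (cells P) (glued_space P' c') \<Theta>"
  proof (rule continuous_map_from_prod_discrete)
    fix v :: "bit ^ 'n"
    \<comment> \<open>All indices from 2 on name \<open>K1\<close>, so closedness and continuity can
      be claimed for every n.\<close>
    define T where "T n = (if n = (0::nat) then P1 else if n = 1 then K else K1)" for n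
    have TP: "T n \<subseteq> P" for n
      using P K_sub K1(2) by (auto simp: T_def)
    have Tcl: "closed (T n)" for n
      using compact(2) compact_K K1(1) by (auto simp: T_def compact_imp_closed)
    have "P2 \<subseteq> K \<union> K1"
      by (auto simp: K1_def K_def)
    then have "p \<in> T 0 \<or> p \<in> T 1 \<or> p \<in> T 2" if "p \<in> P" for p
      using that P(1) by (auto simp: T_def)
    then have Tcov: "\<exists>n. n \<in> {0, 1, 2} \<and> p \<in> T n" if "p \<in> P" for p
      using that by blast
    have "continuous_map (top_of_set (T n)) (glued_space P' c') (\<lambda>p. \<Theta> (p, v))" for n
    proof -
      have "continuous_map (top_of_set P1) (glued_space P' c') (\<lambda>p. \<Theta> (p, v))"
        using slice[OF A_cont] by (rule continuous_map_eq) (simp add: \<Theta>A)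
      moreover have "continuous_map (top_of_set K) (glued_space P' c') (\<lambda>p. \<Theta> (p, v))"
        using B_cont by (rule continuous_map_eq) (simp add: \<Theta>K)
      moreover have "continuous_map (top_of_set K1) (glued_space P' c') (\<lambda>p. \<Theta> (p, v))"
        using continuous_map_from_subtopology_mono[OF slice[OF E_cont] K1(2)]
        by (rule continuous_map_eq) (simp add: \<Theta>K1)
      ultimately show ?thesis
        by (simp add: T_def)
    qed
    note Tcont = this
    show "continuous_map (top_of_set P) (glued_space P' c') (\<lambda>p. \<Theta> (p, v))"
    proof (rule pasting_lemma_closed[where I = "{0, 1, 2}" and T = T and f = "\<lambda>_ p. \<Theta> (p, v)"])
      show "closedin (top_of_set P) (T n)" for n
        using TP Tcl by (simp add: closed_subset)
      show "continuous_map (subtopology (top_of_set P) (T n)) (glued_space P' c') (\<lambda>p. \<Theta> (p, v))" for n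
        using Tcont TP by (simp add: subtopology_subtopology Int_absorb1)
    qed (use Tcov in auto)
  qed
  have J_iff: "J (t, x) = J (t', y) \<longleftrightarrow> t = t' \<and> x = y"
    if t: "t \<in> I" "t' \<in> I" and xy: "x \<in> topspace (glued_space S d)" "y \<in> topspace (glued_space S d)"
    for t t' x y
  proof -
    obtain s v s' w where sv: "s \<in> S" "x = qS (s, v)" "s' \<in> S" "y = qS (s', w)"
      using xy by (auto simp: topspace_glued_space)
    have "\<kappa> (s, t) \<in> P2" "\<kappa> (s', t') \<in> P2"
      using \<kappa>(3) sv t by blast+
    then have "J (t, x) = J (t', y) \<longleftrightarrow> \<kappa> (s, t) = \<kappa> (s', t') \<and> v + w \<in> local_span P c (\<kappa> (s, t))"
      using J(2) sv t E_eq_iff by simp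
    also have "\<kappa> (s, t) = \<kappa> (s', t') \<longleftrightarrow> s = s' \<and> t = t'"
      using inj_on_eq_iff[OF \<kappa>(2), of "(s, t)" "(s', t')"] sv t by simp
    also have "local_span P c (\<kappa> (s, t)) = local_span S d s"
      using spanS \<kappa>(5) sv t by simp
    finally show ?thesis
      by (auto simp: sv glue_class_eq_iff)
  qed
  have h_iff: "h (t, qS (s, v)) = h (t, qS (s', w)) \<longleftrightarrow> s = s' \<and> v + w \<in> local_span P c (\<kappa> (s, t))"
    if "t \<in> I" "s \<in> S" "s' \<in> S" for t s v s' w
  proof -
    have "inj_on (\<lambda>x. h (t, x)) (topspace (glued_space S d))"
      using h(4)[OF that(1)] bij_betw_def by blast
    then have "h (t, qS (s, v)) = h (t, qS (s', w)) \<longleftrightarrow> qS (s, v) = qS (s', w)"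
      using that by (intro inj_on_eq_iff[where f = "\<lambda>x. h (t, x)"]) (auto simp: topspace_glued_space)
    then show ?thesis
      using spanS[OF that(2)] \<kappa>(5)[OF that(2,1)] by (simp add: glue_class_eq_iff)
  qed
  \<comment> \<open>The stages preserve the levels of the collar. So a value over \<open>P2\<close>
    is an \<open>E\<close>-value at a point on the same side of the collar's edge, and that point is
    on the sector only if p is. This keeps the images of the regions apart.\<close>
  have \<Theta>_P2: "\<exists>p1 u. \<Theta> (p, v) = E (p1, u) \<and> p1 \<in> P2 \<and> (p1 \<in> K \<longleftrightarrow> p \<in> K) \<and> (p1 \<in> i ` S \<longrightarrow> p \<in> P1)"
    if p: "p \<in> P2" for p v
  proof (cases "p \<in> K")
    case True
    then obtain s t where st: "s \<in> S" "t \<in> I" "p = \<kappa> (s, t)"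
      by (auto simp: K_def)
    obtain s1 v1 where s1: "s1 \<in> S" "h (t, qS (s, v)) = qS (s1, v1)"
      using h_class[OF st(1,2)] by metis
    have "\<Theta> (p, v) = E (\<kappa> (s1, t), v1)"
      using \<Theta>B[OF st(1,2)] st(3) s1 J(2)[OF s1(1) st(2)] by simp
    moreover have K: "\<kappa> (s1, t) \<in> K"
      using s1 st by (auto simp: K_def)
    moreover have "p \<in> P1" if "\<kappa> (s1, t) \<in> i ` S"
    proof -
      have "t = 0"
        using \<kappa>_P1[OF s1(1) st(2)] that P(2) by blast
      then show ?thesis
        using st \<kappa>(4) P(2) by auto
    qed
    ultimately show ?thesis
      using True K_sub by blast
  next
    case False
    then show ?thesis
      using \<Theta>E p P(2) by blast
  qed
  have sep1: "p' \<in> P1" if "\<Theta> (p, v) = \<Theta> (p', w)" "p \<in> P1" "p' \<in> P" for p v p' w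
  proof (rule ccontr)
    assume "p' \<notin> P1"
    then have "p' \<in> P2"
      using that P by blast
    then obtain p1 u where p1: "\<Theta> (p', w) = E (p1, u)" "p1 \<in> P2" "p1 \<in> i ` S \<longrightarrow> p' \<in> P1"
      using \<Theta>_P2 by blast
    then have "p1 \<in> i ` S"
      using E_neq_A[OF p1(2) that(2), of u v] that(1) \<Theta>A[OF that(2)] by simp
    then show False
      using p1 \<open>p' \<notin> P1\<close> by blast
  qed
  have sep2: "p \<in> K \<longleftrightarrow> p' \<in> K" if eq: "\<Theta> (p, v) = \<Theta> (p', w)" and p: "p \<in> P2" and p': "p' \<in> P2" for p v p' w
  proof -
    obtain p1 u where p1: "\<Theta> (p, v) = E (p1, u)" "p1 \<in> P2" "p1 \<in> K \<longleftrightarrow> p \<in> K"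
      using \<Theta>_P2[OF p] by blast
    obtain p2 u' where p2: "\<Theta> (p', w) = E (p2, u')" "p2 \<in> P2" "p2 \<in> K \<longleftrightarrow> p' \<in> K"
      using \<Theta>_P2[OF p'] by blast
    have "p1 = p2"
      using E_eq_iff[OF p1(2) p2(2)] eq p1(1) p2(1) by simp
    then show ?thesis
      using p1 p2 by simp
  qed
  \<comment> \<open>Equal values put both points in \<open>P1\<close>, both in the collar, or both
    in the remainder. The three cases use the fibres of \<open>A\<close>, injectivity of
    \<open>J\<close> together with that of the stages, and the fibres of \<open>E\<close>.\<close>
  have fibres: "\<Theta> (p, v) = \<Theta> (p', w) \<longleftrightarrow> p = p' \<and> v + w \<in> local_span P c p"
    if pp: "p \<in> P" "p' \<in> P" for p v p' w
  proof (cases "p \<in> P1 \<or> p' \<in> P1")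
    case True
    then show ?thesis
      using sep1[of p v p' w] sep1[of p' w p v] pp \<Theta>A A_eq_iff by metis
  next
    case False
    then have P2: "p \<in> P2" "p' \<in> P2"
      using pp P by auto
    show ?thesis
    proof (cases "p \<in> K \<longleftrightarrow> p' \<in> K")
      case False
      then show ?thesis
        using sep2[OF _ P2] by blast
    next
      case same: True
      show ?thesis
      proof (cases "p \<in> K")
        case True
        then obtain s t s' t' where st: "s \<in> S" "t \<in> I" "p = \<kappa> (s, t)"
          and st': "s' \<in> S" "t' \<in> I" "p' = \<kappa> (s', t')"
          using same by (auto simp: K_def)
        have top: "h (u, qS (r, x)) \<in> topspace (glued_space S d)" if "r \<in> S" "u \<in> I" for r u x
          using h(4)[OF that(2)] that(1) bij_betwE by (fastforce simp: topspace_glued_space)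
        have "\<Theta> (p, v) = \<Theta> (p', w) \<longleftrightarrow> t = t' \<and> h (t, qS (s, v)) = h (t', qS (s', w))"
          using \<Theta>B[OF st(1,2)] \<Theta>B[OF st'(1,2)] J_iff[OF st(2) st'(2) top[OF st(1,2)] top[OF st'(1,2)]]
          by (simp add: st(3) st'(3))
        also have "\<dots> \<longleftrightarrow> t = t' \<and> s = s' \<and> v + w \<in> local_span P c p"
          using h_iff[OF st(2,1) st'(1)] st(3) by auto
        also have "\<dots> \<longleftrightarrow> p = p' \<and> v + w \<in> local_span P c p"
          using inj_on_eq_iff[OF \<kappa>(2), of "(s, t)" "(s', t')"] st st' by auto
        finally show ?thesis .
      next
        case False
        then show ?thesis
          using same \<Theta>E P2 E_eq_iff[OF P2] by simp
      qed
    qed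
  qed
  have onto: "\<Theta> ` (P \<times> UNIV) = topspace (glued_space P' c')"
  proof
    show "\<Theta> ` (P \<times> UNIV) \<subseteq> topspace (glued_space P' c')"
      using continuous_map_image_subset_topspace[OF \<Theta>_cont] by simp
    show "topspace (glued_space P' c') \<subseteq> \<Theta> ` (P \<times> UNIV)"
    proof
      fix x assume "x \<in> topspace (glued_space P' c')"
      then obtain p' v where x: "x = q' (p', v)" "p' \<in> P'"
        by (auto simp: topspace_glued_space)
      show "x \<in> \<Theta> ` (P \<times> UNIV)"
      proof (cases "p' \<in> P1'")
        case True
        then obtain p where "p \<in> P1" "p' = g1 p"
          using g1(2) by blast
        then have "x = \<Theta> (p, v)" "p \<in> P"
          using \<Theta>A P by (auto simp: x A_def)
        then show ?thesis by blast
      next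
        case False
        then obtain p where p: "p \<in> P2" "p' = g2 p"
          using g2(2) x(2) P' by blast
        define u where "u = \<rho> v + v0"
        have xE: "x = E (p, u)"
          using \<sigma>(2) by (simp add: x p E_def u_def add.assoc vec_bit_add_self)
        show ?thesis
        proof (cases "p \<in> K")
          case True
          then obtain s t where st: "s \<in> S" "t \<in> I" "p = \<kappa> (s, t)"
            by (auto simp: K_def)
          \<comment> \<open>The required class is hit at the same level t, because the stage of the
            isotopy at time t is onto.\<close>
          have "qS (s, u) \<in> topspace (glued_space S d)"
            using st by (auto simp: topspace_glued_space)
          then obtain y where y: "y \<in> topspace (glued_space S d)" "h (t, y) = qS (s, u)"
            using bij_betw_imp_surj_on[OF h(4)[OF st(2)]] by (metis imageE)
          then obtain s1 u1 where s1: "s1 \<in> S" "y = qS (s1, u1)"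
            by (auto simp: topspace_glued_space)
          have "x = \<Theta> (\<kappa> (s1, t), u1)"
            using \<Theta>B[OF s1(1) st(2)] y s1 J(2)[OF st(1,2)] xE st(3) by simp
          moreover have "\<kappa> (s1, t) \<in> P"
            using \<kappa>(3) s1 st P by blast
          ultimately show ?thesis by blast
        next
          case False
          then have "x = \<Theta> (p, u)" "p \<in> P"
            using \<Theta>E p P xE by auto
          then show ?thesis by blast
        qed
      qed
    qed
  qed
  show ?thesis
    using compact(1) H \<Theta>_cont onto fibres by (rule homeomorphic_glued_spaceI)
qed

end

section \<open>The gluing data of colored polytopes\<close>

theorem theorem3p3:
  fixes P P' P1 P2 :: "(real ^ 'n) set"
    and S :: "'b::euclidean_space set"
    and lam lam' :: "(real ^ 'n) set \<Rightarrow> bit ^ 'n"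
    and i :: "'b \<Rightarrow> real ^ 'n"
    and \<psi> :: "'b \<Rightarrow> 'b"
    and \<rho> :: "bit ^ 'n ^ 'n"
    and v0 :: "bit ^ 'n"
  assumes "simple_polytope CARD('n) P" and "coloring P lam"
    and "simple_polytope (CARD('n) - 1) S" and "sector S P i P1 P2"
    and "iso_pair S (derived_coloring P lam i) \<psi> \<rho>"
    and "simple_polytope CARD('n) P'" and "coloring P' lam'"
    and "obtained_by S P lam i P1 P2 \<psi> \<rho> P' lam'"
    and "good_twist S (derived_coloring P lam i) \<psi> \<rho> v0"
  shows "glued_space P lam homeomorphic_space glued_space P' lam'"
proof -
  obtain j P1' P2' g1 g2 where j: "sector S P' j P1' P2'"
    and g1: "corner_homeo P1 (piece_facets P (i ` S) P1) P1' (piece_facets P' (j ` S) P1') g1"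
    and g2: "corner_homeo P2 (piece_facets P (i ` S) P2) P2' (piece_facets P' (j ` S) P2') g2"
    and g1j: "\<forall>s \<in> S. g1 (i s) = j s" and g2j: "\<forall>s \<in> S. g2 (i (\<psi> s)) = j s"
    and col1: "\<forall>F \<in> facets P'. F \<inter> P1' \<noteq> {} \<longrightarrow>
      (\<forall>F1 \<in> facets P. F1 \<inter> P1 \<noteq> {} \<and> g1 ` (F1 \<inter> P1) \<subseteq> F \<longrightarrow> lam' F = lam F1)"
    and col2: "\<forall>F \<in> facets P'. F \<inter> P2' \<noteq> {} \<longrightarrow>
      (\<forall>F2 \<in> facets P. F2 \<inter> P2 \<noteq> {} \<and> g2 ` (F2 \<inter> P2) \<subseteq> F \<longrightarrow>
        lam' F = matrix_inv \<rho> *v lam F2)"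
    using assms(8) unfolding obtained_by_def by (elim exE conjE)
  define d where "d = derived_coloring P lam i"
  interpret A1: cut_polytope S P P1 P2 i
    using assms by unfold_locales
  interpret A2: cut_polytope S P P2 P1 i
    by (rule A1.swap)
  interpret B1: cut_polytope S P' P1' P2' j
    using assms j by unfold_locales
  interpret B2: cut_polytope S P' P2' P1' j
    by (rule B1.swap)
  have inv: "invertible \<rho>" and "\<psi> \<in> Aut S"
    using assms(5) by (simp_all add: iso_pair_def)
  then have \<psi>S: "\<psi> ` S = S"
    using corner_homeoD(2)[of S "facets S" S "facets S" \<psi>] by (simp add: Aut_def)
  have \<sigma>\<rho>: "matrix_inv \<rho> *v (\<rho> *v v) = v" and \<rho>\<sigma>: "\<rho> *v (matrix_inv \<rho> *v v) = v" for v
  proof -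
    \<comment> \<open>\<open>matrix_inv\<close> is a choice; invertibility guarantees that the
      chosen matrix is a two-sided inverse.\<close>
    have "\<rho> ** matrix_inv \<rho> = mat 1 \<and> matrix_inv \<rho> ** \<rho> = mat 1"
      using inv unfolding invertible_def matrix_inv_def by (rule someI_ex)
    then show "matrix_inv \<rho> *v (\<rho> *v v) = v" "\<rho> *v (matrix_inv \<rho> *v v) = v"
      by (simp_all add: matrix_vector_mul_assoc)
  qed
  have g1S: "g1 ` i ` S = j ` S"
    using g1j by (simp add: image_image)
  have "g2 ` i ` \<psi> ` S = j ` S"
    using g2j by (simp add: image_image)
  then have g2S: "g2 ` i ` S = j ` S"
    by (simp add: \<psi>S)
  have span1: "local_span P' lam' (g1 p) = local_span P lam p" if "p \<in> P1" for p
    using piece_colors[OF A1.cut_polytope_axioms B1.cut_polytope_axioms g1 g1S, of lam' "\<lambda>u. u" lam p]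
      col1 that by (simp add: local_span_def)
  \<comment> \<open>The span itself changes on the second piece, by the inverse matrix; injectivity
    of that matrix turns the image into the equivalence needed below.\<close>
  have "local_span P' lam' (g2 p) = (*v) (matrix_inv \<rho>) ` local_span P lam p" if "p \<in> P2" for p
    using piece_colors[OF A2.cut_polytope_axioms B2.cut_polytope_axioms g2 g2S, of lam' "(*v) (matrix_inv \<rho>)" lam p]
      col2 that by (intro local_span_image) simp
  moreover have "inj ((*v) (matrix_inv \<rho>))"
    by (rule inj_on_inverseI) (rule \<rho>\<sigma>)
  ultimately have span2: "matrix_inv \<rho> *v u \<in> local_span P' lam' (g2 p) \<longleftrightarrow> u \<in> local_span P lam p"
    if "p \<in> P2" for p u
    using that by (simp add: inj_image_mem_iff)
  \<comment> \<open>The swapped instance places the collar in \<open>P2\<close>, the side on which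
    the correction by the isotopy is made.\<close>
  obtain \<kappa> where \<kappa>: "continuous_on (S \<times> {0..1}) \<kappa>" "inj_on \<kappa> (S \<times> {0..1})" "\<kappa> ` (S \<times> {0..1}) \<subseteq> P2"
    "\<forall>s \<in> S. \<kappa> (s, 0) = i s"
    "\<forall>F \<in> facets P. \<forall>s \<in> S. \<forall>t \<in> {0..1::real}. \<kappa> (s, t) \<in> F \<longleftrightarrow> i s \<in> F"
    "openin (top_of_set P2) (\<kappa> ` (S \<times> {0..<1}))"
    using A2.sector_collar .
  have \<kappa>_span: "local_span P lam (\<kappa> (s, t)) = local_span P lam (i s)" if "s \<in> S" "t \<in> {0..1}" for s t
    using \<kappa>(5) that unfolding local_span_def by (metis (no_types, lifting) Collect_cong)
  obtain h where h: "continuous_map (prod_topology (top_of_set {0..1::real}) (glued_space S d)) (glued_space S d) h"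
    "\<forall>x. h (0, x) = twist S d \<psi> \<rho> v0 x" "\<forall>x. h (1, x) = id x"
    "\<forall>t \<in> {0..1}. homeomorphic_map (glued_space S d) (glued_space S d) (\<lambda>x. h (t, x))"
    using assms(9) unfolding good_twist_def isotopic_to_id_def homotopic_with_def d_def by (elim exE conjE)
  have "regluing P P1 P2 P' P1' P2' S i j g1 g2 \<psi> lam lam' d ((*v) \<rho>) ((*v) (matrix_inv \<rho>)) v0 \<kappa> h"
  proof (rule regluing.intro)
    show "compact P" "compact P1" "compact P2" "compact S"
      using A1.P_props(2) A1.compact_piece A2.compact_piece A1.S_props(2) by auto
    show "P1 \<union> P2 = P" "P1 \<inter> P2 = i ` S" "P1' \<union> P2' = P'" "P1' \<inter> P2' = j ` S"
      by (rule A1.pieces B1.pieces)+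
    show "Hausdorff_space (glued_space P' lam')"
      by (intro Hausdorff_glued_space B1.P_props)
    show "continuous_on P1 g1" "g1 ` P1 = P1'" "inj_on g1 P1"
      by (rule corner_homeoD[OF g1])+
    show "continuous_on P2 g2" "g2 ` P2 = P2'" "inj_on g2 P2"
      by (rule corner_homeoD[OF g2])+
    show "local_span S d s = local_span P lam (i s)" if "s \<in> S" for s
      unfolding d_def using that by (rule A1.local_span_sector)
    show "h (0, glue_class S d (s, v)) = glue_class S d (\<psi> s, \<rho> *v v + v0)" for s v
      using h(2) twist_glue_class[OF assms(5)] by (simp add: d_def)
    show "bij_betw (\<lambda>x. h (t, x)) (topspace (glued_space S d)) (topspace (glued_space S d))"
      if "t \<in> {0..1}" for t
      using h(4) that homeomorphic_imp_injective_map homeomorphic_imp_surjective_map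
      unfolding bij_betw_def by blast
  qed (use g1j g2j \<psi>S span1 span2 \<sigma>\<rho> \<kappa> \<kappa>_span h in \<open>simp_all add: matrix_vector_right_distrib\<close>)
  then show ?thesis
    by (rule regluing.glued_spaces_homeomorphic)
qed


end
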